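(* Let $\Phi$ be an irreducible reduced root system with Weyl group $W$ and index of connection $f$, and let $q\in\mathbb{Z}_{>0}$. If $\gcd\{f,q\} = 1$, then $$\chi_{\Phi,q} = \frac{\chi^{\mathrm{quasi}}_{\Phi}(q)}{\#W}\cdot\chi_{\mathrm{R}},$$ where $\chi_{\mathrm{R}}$ is the regular character of $W$ (i.e. $\chi_{\mathrm{R}}(1) = \#W$ and $\chi_{\mathrm{R}}(w) = 0$ for $w\ne1$). Furthermore, let $\tilde n_\Phi$ denote the minimum period of $\chi^{\mathrm{quasi}}_\Phi$. If $q$ is coprime to both $f$ and $\tilde n_\Phi$, then $$\chi_{\Phi,q} = \frac{\chi_{\mathcal{A}_\Phi}(q)}{\#W}\cdot\chi_{\mathrm{R}}.$$
   Context: Let $E$ be the Euclidean space of dimension $\ell$ with inner product $(\cdot,\cdot)$ containing the (crystallographic, spanning) root system $\Phi$. The coweight lattice is $Z := \{x\in E : (\alpha,x)\in\mathbb{Z}\ \forall\alpha\in\Phi\}$, the coroot lattice $Q^\vee$ is generated by $2\alpha/(\alpha,\alpha)$, $\alpha\in\Phi$, and the index of connection is $f := (Z:Q^\vee)$. For $q\in\mathbb{Z}_{>0}$, $M(\Phi;q) := \{x+qZ\in Z/qZ : (\beta,x)\not\equiv0\pmod q\ \forall\beta\in\Phi\}$. $W$ acts on it via $w(x+qZ)=w(x)+qZ$, and $\chi_{\Phi,q}(w) := \#\{t\in M(\Phi;q) : w(t)=t\}$ is the permutation character. The characteristic quasi-polynomial is $\chi^{\mathrm{quasi}}_\Phi(q)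 := \#M(\Phi;q) = \chi_{\Phi,q}(1)$, a quasi-polynomial in $q$; its minimum period is the least $\tilde n>0$ such that there are polynomials $f^{(1)},\dots,f^{(\tilde n)}$ with $\chi^{\mathrm{quasi}}_\Phi(q) = f^{(r)}(q)$ for $q\equiv r\pmod{\tilde n}$. $\chi_{\mathcal{A}_\Phi}(t)$ is the characteristic polynomial of the Coxeter arrangement $\mathcal{A}_\Phi = \{\beta^\perp : \beta\in\Phi\}$ in $E$. *)

theory Defs
  imports
    "HOL-Analysis.Analysis"
    "HOL-Algebra.Generated_Groups"
    "HOL-Algebra.Group_Action"
    "HOL-Number_Theory.Cong"
    "HOL-Library.Real_Mod"
begin

definition coroot :: "'a::euclidean_space \<Rightarrow> 'a" where
  "coroot \<alpha> = (2 / (\<alpha> \<bullet> \<alpha>)) *\<^sub>R \<alpha>"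

definition reflection :: "'a::euclidean_space \<Rightarrow> 'a \<Rightarrow> 'a" where
  "reflection \<alpha> x = x - (x \<bullet> coroot \<alpha>) *\<^sub>R \<alpha>"

definition root_system :: "'a::euclidean_space set \<Rightarrow> bool" where
  "root_system \<Phi> \<longleftrightarrow>
     finite \<Phi> \<and> 0 \<notin> \<Phi> \<and> span \<Phi> = UNIV \<and>
     (\<forall>\<alpha>\<in>\<Phi>. reflection \<alpha> ` \<Phi> = \<Phi>) \<and>
     (\<forall>\<alpha>\<in>\<Phi>. \<forall>\<beta>\<in>\<Phi>. \<beta> \<bullet> coroot \<alpha> \<in> \<int>)"

definition reduced_roots :: "'a::euclidean_space set \<Rightarrow> bool" where
  "reduced_roots \<Phi> \<longleftrightarrow> (\<forall>\<alpha>\<in>\<Phi>. \<forall>c. c *\<^sub>R \<alpha> \<in> \<Phi> \<longrightarrow> c = 1 \<or> c = -1)"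

definition irreducible_roots :: "'a::euclidean_space set \<Rightarrow> bool" where
  "irreducible_roots \<Phi> \<longleftrightarrow>
     \<Phi> \<noteq> {} \<and>
     \<not> (\<exists>\<Phi>1 \<Phi>2. \<Phi>1 \<noteq> {} \<and> \<Phi>2 \<noteq> {} \<and> \<Phi>1 \<union> \<Phi>2 = \<Phi> \<and> \<Phi>1 \<inter> \<Phi>2 = {} \<and>
          (\<forall>\<alpha>\<in>\<Phi>1. \<forall>\<beta>\<in>\<Phi>2. \<alpha> \<bullet> \<beta> = 0))"

definition weyl_group :: "'a::euclidean_space set \<Rightarrow> ('a \<Rightarrow> 'a) monoid" where
  "weyl_group \<Phi> = subgroup_generated (BijGroup UNIV) (reflection ` \<Phi>)"

definition regular_character :: "'g monoid \<Rightarrow> 'g \<Rightarrow> complex" where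
  "regular_character G g = (if g = \<one>\<^bsub>G\<^esub> then of_nat (Coset.order G) else 0)"

definition coweight_lattice :: "'a::euclidean_space set \<Rightarrow> 'a set" where
  "coweight_lattice \<Phi> = {x. \<forall>\<alpha>\<in>\<Phi>. \<alpha> \<bullet> x \<in> \<int>}"

text \<open>The lattice as an (additively written) group, so that cosets and indices are those of
  HOL-Algebra.\<close>

definition coweight_group :: "'a::euclidean_space set \<Rightarrow> 'a monoid" where
  "coweight_group \<Phi> = \<lparr>carrier = coweight_lattice \<Phi>, monoid.mult = (+), one = 0\<rparr>"

definition coroot_lattice :: "'a::euclidean_space set \<Rightarrow> 'a set" where
  "coroot_lattice \<Phi> = generate (coweight_group \<Phi>) (coroot ` \<Phi>)"

definition index_of_connection :: "'a::euclidean_space set \<Rightarrow> nat" where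
  "index_of_connection \<Phi> = Coset.order (coweight_group \<Phi> Mod coroot_lattice \<Phi>)"

definition scaled_coweight_lattice :: "'a::euclidean_space set \<Rightarrow> nat \<Rightarrow> 'a set" where
  "scaled_coweight_lattice \<Phi> q = (\<lambda>x. real q *\<^sub>R x) ` coweight_lattice \<Phi>"

definition mod_complement :: "'a::euclidean_space set \<Rightarrow> nat \<Rightarrow> 'a set set" where
  "mod_complement \<Phi> q =
     {scaled_coweight_lattice \<Phi> q #>\<^bsub>coweight_group \<Phi>\<^esub> x | x.
        x \<in> coweight_lattice \<Phi> \<and> (\<forall>\<beta>\<in>\<Phi>. \<not> [\<beta> \<bullet> x = 0] (rmod real q))}"

text \<open>As every w in the Weyl group is linear and preserves the scaled lattice, the image of a coset
  under w is the coset of w(x): the action on cosets is the image operator.\<close>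

definition perm_character :: "'a::euclidean_space set \<Rightarrow> nat \<Rightarrow> ('a \<Rightarrow> 'a) \<Rightarrow> complex" where
  "perm_character \<Phi> q w = of_nat (card (invariants (mod_complement \<Phi> q) (\<lambda>w t. w ` t) w))"

definition char_quasi :: "'a::euclidean_space set \<Rightarrow> nat \<Rightarrow> nat" where
  "char_quasi \<Phi> q = card (mod_complement \<Phi> q)"

definition quasi_period :: "(nat \<Rightarrow> nat) \<Rightarrow> nat \<Rightarrow> bool" where
  "quasi_period F n \<longleftrightarrow>
     n > 0 \<and>
     (\<exists>f :: nat \<Rightarrow> real poly. \<forall>r\<in>{1..n}. \<forall>q>0.
        [q = r] (mod n) \<longrightarrow> real (F q) = poly (f r) (real q))"

definition min_period :: "(nat \<Rightarrow> nat) \<Rightarrow> nat" where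
  "min_period F = (LEAST n. quasi_period F n)"

definition coxeter_arrangement :: "'a::euclidean_space set \<Rightarrow> 'a set set" where
  "coxeter_arrangement \<Phi> = {{x. \<beta> \<bullet> x = 0} | \<beta>. \<beta> \<in> \<Phi>}"

text \<open>The empty intersection is the whole space.\<close>

definition intersection_lattice :: "'a set set \<Rightarrow> 'a set set" where
  "intersection_lattice A = {\<Inter> B | B. B \<subseteq> A}"

text \<open>The Moebius function mu(E, X) of an intersection lattice L, ordered by reverse inclusion with
  least element the whole space E. The value for infinite L is a dummy that makes the recursion
  terminate.\<close>

function moebius :: "'a set set \<Rightarrow> 'a set \<Rightarrow> int" where
  "moebius L X =
     (if infinite L then 0
      else if X = UNIV then 1
      else - (\<Sum>Y\<in>{Y\<in>L. X \<subset> Y}. moebius L Y))"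
  by auto
termination
proof (relation "Wellfounded.measure (\<lambda>(L, X). card {Y\<in>L. X \<subset> Y})", goal_cases)
  case 1
  show ?case by simp
next
  case (2 L X Y)
  then have "{Z\<in>L. Y \<subset> Z} \<subset> {Z\<in>L. X \<subset> Z}" "finite {Z\<in>L. X \<subset> Z}"
    by auto
  then show ?case
    by (simp add: psubset_card_mono)
qed

declare moebius.simps [simp del]

definition arrangement_char_poly :: "'a::euclidean_space set set \<Rightarrow> int poly" where
  "arrangement_char_poly A =
     (\<Sum>X\<in>intersection_lattice A. monom (moebius (intersection_lattice A) X) (dim X))"

end

theory Submission
  imports Defs "HOL-Algebra.Multiplicative_Group"
begin

text \<open>
  Both statements come from one fact, \<open>no_fixed_points\<close>: if \<open>q\<close> is coprime to the index of
  connection \<open>f\<close>, then no \<open>w \<noteq> 1\<close> in the Weyl group \<open>W\<close> fixes a point of \<open>M(\<Phi>; q)\<close>. A permutation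
  character without fixed points off the identity is the number of points divided by \<open>#W\<close>, times
  the regular character.

  To see this fact, let \<open>w\<close> fix the class of \<open>x\<close> in \<open>Z / q Z\<close>, say \<open>w x = x + q z\<close> with \<open>z \<in> Z\<close>.
  A reflection moves a coweight by an integer multiple of a coroot, so \<open>w x - x\<close> is in the coroot
  lattice, and \<open>q z\<close> is in it. So is \<open>f z\<close>, because \<open>f\<close> is the order of \<open>Z\<close> modulo the coroot
  lattice. Since \<open>f\<close> and \<open>q\<close> are coprime, \<open>z\<close> itself is in the coroot lattice. Then
  \<open>y \<mapsto> w y - q z\<close> lies in the affine Weyl group of the hyperplanes \<open>\<beta> \<bullet> y = q k\<close>, and it fixes \<open>x\<close>,
  which is on none of these hyperplanes. An affine reflection group acts freely on its chambers
  (\<open>affine_weyl_free\<close>, from \<open>mirrors_free\<close>), so this map is the identity, and \<open>w = 1\<close>.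

  For the second statement one must identify \<open>#M(\<Phi>; q)\<close> with \<open>\<chi>(q)\<close>, where \<open>\<chi>\<close> is the
  characteristic polynomial of the Coxeter arrangement. Inclusion-exclusion over sets \<open>B\<close> of roots
  reduces the count to the number of \<open>x\<close> in \<open>Z / q Z\<close> with \<open>\<beta> \<bullet> x \<equiv> 0\<close> for all \<open>\<beta> \<in> B\<close>. These are the
  \<open>q\<close>-torsion points of the group of all \<open>x\<close> in the torus \<open>E / Z\<close> on which every \<open>\<beta> \<in> B\<close> is integral.
  The identity component of this group is a torus of dimension \<open>dim B\<^sup>\<bottom>\<close>, which is divisible, and its
  component group has finite exponent. Hence the number is \<open>q ^ dim B\<^sup>\<bottom>\<close> times a factor that is
  periodic in \<open>q\<close> and equals \<open>1\<close> when \<open>q\<close> is coprime to the exponent (\<open>idx_div_lattice\<close>,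
  \<open>component_torsion_periodic\<close>). So \<open>#M(\<Phi>; q)\<close> is a quasi-polynomial in \<open>q\<close>, and for all \<open>q\<close> coprime
  to some \<open>N\<close> it is \<open>\<Sum>\<^sub>B (-1)\<^bsup>#B\<^esup> q\<^bsup>dim B\<^sup>\<bottom>\<^esup>\<close>, which is \<open>\<chi>(q)\<close> by Whitney's formula for the
  Moebius function (\<open>arrangement_char_poly_whitney\<close>).

  Finally let \<open>q\<close> be coprime to the minimum period \<open>n\<close>. The residue class of \<open>q\<close> modulo \<open>n\<close> contains
  infinitely many numbers coprime to \<open>N\<close>, so the constituent of this class agrees with \<open>\<chi>\<close>
  infinitely often, hence everywhere, in particular at \<open>q\<close> (\<open>char_quasi_eq_char_poly\<close>).
\<close>

section \<open>Affine reflection groups act freely on chambers\<close>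

text \<open>A pair \<open>(e, c)\<close> with \<open>e\<close> a unit vector stands for the oriented hyperplane \<open>e \<bullet> z = c\<close>. Unit normals
  make \<open>aff\<close> the signed distance, so that distances to different hyperplanes can be compared.\<close>

definition aff :: "'a::euclidean_space \<times> real \<Rightarrow> 'a \<Rightarrow> real" where
  "aff u z = fst u \<bullet> z - snd u"

definition mirror :: "'a::euclidean_space \<times> real \<Rightarrow> 'a \<Rightarrow> 'a" where
  "mirror u z = z - (2 * aff u z) *\<^sub>R fst u"

text \<open>The action of the mirror of \<open>u\<close> on affine functionals by composition; see \<open>aff_mirror\<close>.\<close>

definition mirror_root :: "'a::euclidean_space \<times> real \<Rightarrow> 'a \<times> real \<Rightarrow> 'a \<times> real" where
  "mirror_root u v = (fst v - (2 * (fst u \<bullet> fst v)) *\<^sub>R fst u, snd v - 2 * (fst u \<bullet> fst v) * snd u)"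

lemma aff_mirror: "aff v (mirror u z) = aff (mirror_root u v) z"
  by (simp add: aff_def mirror_def mirror_root_def algebra_simps inner_commute)

lemma aff_uminus [simp]: "aff (- u) z = - aff u z"
  by (simp add: aff_def)

lemma aff_mirror_expand: "aff v (mirror u z) = aff v z - 2 * aff u z * (fst u \<bullet> fst v)"
  by (simp add: aff_def mirror_def algebra_simps inner_commute)

text \<open>The last condition says that only finitely many hyperplanes separate two given points; this is
  how local finiteness enters.\<close>

locale affine_roots =
  fixes U :: "('a::euclidean_space \<times> real) set"
  assumes unit: "u \<in> U \<Longrightarrow> fst u \<bullet> fst u = 1"
    and mirror_root_closed: "\<lbrakk>u \<in> U; v \<in> U\<rbrakk> \<Longrightarrow> mirror_root u v \<in> U"
    and locally_finite: "finite {u \<in> U. aff u y > 0 \<and> aff u z < 0}"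
begin

lemma mirror_root_self: "u \<in> U \<Longrightarrow> mirror_root u u = - u"
  by (simp add: mirror_root_def unit prod_eq_iff scaleR_2)

lemma uminus_closed: "u \<in> U \<Longrightarrow> - u \<in> U"
  using mirror_root_closed[of u u] by (simp add: mirror_root_self)

lemma aff_mirror_self: "u \<in> U \<Longrightarrow> aff u (mirror u z) = - aff u z"
  by (simp add: aff_mirror mirror_root_self)

lemma mirror_mirror: "u \<in> U \<Longrightarrow> mirror u (mirror u z) = z"
  using aff_mirror_self[of u z] by (simp add: mirror_def)

lemma mirror_root_inv:
  assumes "u \<in> U" shows "mirror_root u (mirror_root u v) = v"
proof -
  have "fst u \<bullet> (fst v - (2 * (fst u \<bullet> fst v)) *\<^sub>R fst u) = - (fst u \<bullet> fst v)"
    using unit[OF assms] by (simp add: algebra_simps)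
  then show ?thesis by (simp add: mirror_root_def prod_eq_iff)
qed

lemma mirror_conj:
  assumes u: "u \<in> U"
  shows "mirror (mirror_root u v) z = mirror u (mirror v (mirror u z))"
proof -
  define a where "a = aff v (mirror u z)"
  have "mirror (mirror_root u v) z = z - (2 * a) *\<^sub>R (fst v - (2 * (fst u \<bullet> fst v)) *\<^sub>R fst u)"
    by (simp add: mirror_def[of "mirror_root u v"] aff_mirror[symmetric] a_def)
      (simp add: mirror_root_def)
  also have "\<dots> = mirror u (mirror u z) - (2 * a) *\<^sub>R (fst v - (2 * (fst u \<bullet> fst v)) *\<^sub>R fst u)"
    by (simp add: mirror_mirror u)
  also have "\<dots> = mirror u (mirror u z - (2 * a) *\<^sub>R fst v)"
    by (simp add: mirror_def[of u] aff_def algebra_simps)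
  also have "mirror u z - (2 * a) *\<^sub>R fst v = mirror v (mirror u z)"
    by (simp add: mirror_def[of v] a_def)
  finally show ?thesis .
qed

end

fun mirrors :: "('a::euclidean_space \<times> real) list \<Rightarrow> 'a \<Rightarrow> 'a" where
  "mirrors [] = id"
| "mirrors (u # us) = mirror u \<circ> mirrors us"

lemma mirrors_append: "mirrors (us @ vs) = mirrors us \<circ> mirrors vs"
  by (induction us) auto

locale chamber = affine_roots U for U :: "('a::euclidean_space \<times> real) set" +
  fixes x :: 'a
  assumes regular: "u \<in> U \<Longrightarrow> aff u x \<noteq> 0"
begin

definition sep :: "'a \<Rightarrow> ('a \<times> real) set" where
  "sep y = {u \<in> U. aff u x > 0 \<and> aff u y < 0}"

definition wall :: "'a \<times> real \<Rightarrow> bool" where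
  "wall s \<longleftrightarrow> s \<in> U \<and> aff s x > 0 \<and> sep (mirror s x) \<subseteq> {s}"

lemma finite_sep: "finite (sep y)"
  using locally_finite[of x y] by (simp add: sep_def)

text \<open>Reflecting in a wall of the chamber changes the side of that wall only.\<close>

lemma mirror_wall_pos:
  assumes "wall s" "v \<in> U" "aff v x > 0" "v \<noteq> s"
  shows "aff (mirror_root s v) x > 0"
proof -
  have "mirror_root s v \<in> U" using assms mirror_root_closed by (auto simp: wall_def)
  then have "aff (mirror_root s v) x \<noteq> 0" by (rule regular)
  moreover have "\<not> aff (mirror_root s v) x < 0"
    using assms by (auto simp: wall_def sep_def aff_mirror)
  ultimately show ?thesis by linarith
qed

text \<open>Walk from \<open>x\<close> to \<open>y\<close> along the segment and consider the hyperplanes that are met first, all at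
  the same point \<open>p\<close>; among these choose the one \<open>s\<close> that is closest to \<open>x\<close>. If the mirror of \<open>s\<close>
  moved \<open>x\<close> across another hyperplane \<open>v\<close>, then \<open>v\<close> and its mirror image would both pass through
  \<open>p\<close>. They would both be at least as far from \<open>x\<close> as \<open>s\<close> is, but the two distances add up to
  \<open>2 cos \<theta>\<close> times the distance of \<open>s\<close>, where \<open>\<theta>\<close> is the angle between \<open>s\<close> and \<open>v\<close>. So \<open>\<theta> = 0\<close>, and
  \<open>v = s\<close>. Taking the closest of the hyperplanes through \<open>p\<close> replaces a perturbation of \<open>y\<close> into
  general position.\<close>

lemma ex_wall_separating:
  assumes "sep y \<noteq> {}"
  shows "\<exists>s \<in> sep y. wall s"
proof -
  define time where "time u = aff u x / (aff u x - aff u y)" for u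
  obtain s0 where s0: "s0 \<in> sep y" "\<And>v. v \<in> sep y \<Longrightarrow> time s0 \<le> time v"
    using arg_min_if_finite[OF finite_sep assms, of time] by (metis linorder_not_less)
  define t where "t = time s0"
  define T where "T = {u \<in> sep y. time u = t}"
  have "finite T" "s0 \<in> T" using finite_sep[of y] s0(1) by (auto simp: T_def t_def)
  then obtain s where s: "s \<in> T" "\<And>v. v \<in> T \<Longrightarrow> aff s x \<le> aff v x"
    using arg_min_if_finite[of T "\<lambda>u. aff u x"] by (metis empty_iff linorder_not_less)
  have sU: "s \<in> U" "aff s x > 0" "aff s y < 0" "s \<in> sep y" "time s = t"
    using s(1) by (auto simp: T_def sep_def)
  have "t = aff s x / (aff s x - aff s y)" using sU(5) by (simp add: time_def)
  then have t: "0 < t" "t < 1"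
    using sU(2,3) by simp_all
  define p where "p = (1 - t) *\<^sub>R x + t *\<^sub>R y"
  have aff_p: "aff u p = (1 - t) * aff u x + t * aff u y" for u
    by (simp add: aff_def p_def algebra_simps)
  have nonneg_p: "aff v p \<ge> 0" if "v \<in> U" "aff v x > 0" for v
  proof (cases "aff v y < 0")
    case True
    then have "t \<le> time v" using that s0(2)[of v] by (simp add: sep_def t_def)
    then have "t * (aff v x - aff v y) \<le> aff v x"
      using True that by (simp add: time_def field_simps)
    then show ?thesis by (simp add: aff_p algebra_simps)
  next
    case False
    then show ?thesis using t that by (simp add: aff_p)
  qed
  have zero_p: "v \<in> T" if v: "v \<in> U" "aff v x > 0" "aff v p = 0" for v
  proof -
    have eq: "(1 - t) * aff v x + t * aff v y = 0" using v(3) by (simp add: aff_p)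
    moreover have "(1 - t) * aff v x > 0" using t v by simp
    ultimately have "t * aff v y < 0" by linarith
    then have y: "aff v y < 0" using t by (simp add: mult_less_0_iff)
    then have "time v = t" using eq v by (simp add: time_def field_simps)
    then show ?thesis using v y by (simp add: T_def sep_def)
  qed
  have s_p: "aff s p = 0"
    using sU(2,3,5) by (simp add: aff_p time_def field_simps)
  have "v = s" if v: "v \<in> sep (mirror s x)" for v
  proof -
    have vU: "v \<in> U" "aff v x > 0" "aff v (mirror s x) < 0"
      using v by (auto simp: sep_def)
    \<comment> \<open>The reflected hyperplane, oriented so that \<open>x\<close> is on its positive side.\<close>
    define g where "g = - mirror_root s v"
    have g: "g \<in> U" "aff g x > 0"
      using vU uminus_closed mirror_root_closed[OF sU(1)] by (auto simp: g_def aff_mirror)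
    have "aff g p = - aff v p"
      using s_p by (simp add: g_def aff_mirror[symmetric] aff_mirror_expand)
    with nonneg_p[OF vU(1,2)] nonneg_p[OF g] have p0: "aff v p = 0" "aff g p = 0" by auto
    have "aff s x \<le> aff v x" "aff s x \<le> aff g x"
      using s(2) zero_p vU g p0 by auto
    moreover have "aff g x = 2 * aff s x * (fst s \<bullet> fst v) - aff v x"
      by (simp add: g_def aff_mirror[symmetric] aff_mirror_expand)
    ultimately have "2 * aff s x * 1 \<le> 2 * aff s x * (fst s \<bullet> fst v)" by linarith
    then have c: "fst s \<bullet> fst v \<ge> 1" using sU(2) by simp
    have "(fst s - fst v) \<bullet> (fst s - fst v) = 2 - 2 * (fst s \<bullet> fst v)"
      using unit[OF sU(1)] unit[OF vU(1)] by (simp add: algebra_simps inner_commute)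
    with c have "(fst s - fst v) \<bullet> (fst s - fst v) \<le> 0" by linarith
    then have "fst s = fst v"
      by (metis eq_iff_diff_eq_0 inner_eq_zero_iff inner_ge_zero order_antisym)
    with p0 s_p show ?thesis by (simp add: aff_def prod_eq_iff)
  qed
  then show ?thesis using sU by (auto simp: wall_def)
qed

text \<open>If \<open>u\<close> is not itself a wall, a wall \<open>s\<close> separates \<open>x\<close> from its mirror image under \<open>u\<close>.
  Conjugating \<open>u\<close> by \<open>s\<close> gives a hyperplane \<open>v\<close> whose mirror separates \<open>x\<close> from its image by fewer
  hyperplanes: the mirror of \<open>s\<close> embeds the set for \<open>v\<close> into the set for \<open>u\<close> without \<open>s\<close>.\<close>

lemma mirror_is_product_of_walls:
  assumes "u \<in> U" "aff u x > 0"
  shows "\<exists>ws. (\<forall>s\<in>set ws. wall s) \<and> mirrors ws = mirror u"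
  using assms
proof (induction "card (sep (mirror u x))" arbitrary: u rule: less_induct)
  case less
  note u = less.prems
  have "u \<in> sep (mirror u x)" using u by (simp add: sep_def aff_mirror_self)
  then obtain s where s: "s \<in> sep (mirror u x)" "wall s" using ex_wall_separating by blast
  have sU: "s \<in> U" "aff s x > 0" "aff s (mirror u x) < 0" using s by (auto simp: sep_def)
  show ?case
  proof (cases "s = u")
    case True
    with s show ?thesis by (intro exI[of _ "[u]"]) auto
  next
    case False
    define v where "v = mirror_root s u"
    have v: "v \<in> U" "aff v x > 0"
      using mirror_root_closed[OF sU(1) u(1)] mirror_wall_pos[OF s(2) u] False by (auto simp: v_def)
    have mirror_v: "mirror v z = mirror s (mirror u (mirror s z))" for z
      by (simp add: v_def mirror_conj sU)
    have pos: "fst u \<bullet> fst s > 0"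
    proof -
      have "2 * aff u x * (fst u \<bullet> fst s) > 0"
        using sU(2,3) by (simp add: aff_mirror_expand)
      then show ?thesis using u(2) by (simp add: zero_less_mult_iff)
    qed
    have "mirror_root s ` sep (mirror v x) \<subseteq> sep (mirror u x) - {s}"
    proof (intro image_subsetI)
      fix t assume "t \<in> sep (mirror v x)"
      then have t: "t \<in> U" "aff t x > 0" "aff t (mirror v x) < 0" by (auto simp: sep_def)
      have "aff s (mirror v x) > 0"
      proof -
        have "aff s (mirror v x) = - aff s (mirror u (mirror s x))"
          by (simp add: mirror_v aff_mirror_self sU)
        also have "\<dots> = aff s x + 2 * aff v x * (fst u \<bullet> fst s)"
          by (simp add: aff_mirror_expand[of s u] aff_mirror_self sU)
            (simp add: v_def aff_mirror)
        finally show ?thesis using sU v pos by (simp add: add_pos_nonneg)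
      qed
      with t have "t \<noteq> s" by auto
      define t' where "t' = mirror_root s t"
      have t'x: "aff t' x > 0" using mirror_wall_pos[OF s(2) t(1,2) \<open>t \<noteq> s\<close>] by (simp add: t'_def)
      have t'U: "t' \<in> U" using mirror_root_closed sU t by (simp add: t'_def)
      have neg: "aff t' (mirror u (mirror s x)) < 0"
        using t(3) by (simp add: t'_def mirror_v aff_mirror[symmetric])
      have "t' \<noteq> s"
      proof
        assume "t' = s"
        then have "t = - s" using mirror_root_inv[OF sU(1), of t] mirror_root_self[OF sU(1)]
          by (simp add: t'_def)
        with t sU show False by simp
      qed
      moreover have "aff t' (mirror u x) < 0"
      proof (rule ccontr)
        assume "\<not> ?thesis"
        moreover have r: "mirror_root u t' \<in> U" using mirror_root_closed u t'U by simp
        moreover from regular[OF r] have "aff t' (mirror u x) \<noteq> 0" by (simp add: aff_mirror)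
        ultimately have "mirror_root u t' \<in> sep (mirror s x)"
          using neg by (auto simp: sep_def aff_mirror)
        then have "mirror_root u t' = s" using s(2) by (auto simp: wall_def)
        then have "t' = mirror_root u s" using mirror_root_inv[OF u(1)] by metis
        then have "aff t' x = aff s (mirror u x)" by (simp add: aff_mirror)
        with t'x sU show False by simp
      qed
      ultimately show "mirror_root s t \<in> sep (mirror u x) - {s}"
        using t'U t'x by (simp add: sep_def t'_def)
    qed
    then have "card (mirror_root s ` sep (mirror v x)) \<le> card (sep (mirror u x) - {s})"
      by (intro card_mono) (auto simp: finite_sep)
    moreover have "inj_on (mirror_root s) (sep (mirror v x))"
      by (metis inj_on_inverseI mirror_root_inv sU(1))
    moreover have "card (sep (mirror u x) - {s}) < card (sep (mirror u x))"
      using s finite_sep by (intro psubset_card_mono) auto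
    ultimately have "card (sep (mirror v x)) < card (sep (mirror u x))"
      by (simp add: card_image)
    from less.hyps[OF this v] obtain ws where ws: "\<forall>s\<in>set ws. wall s" "mirrors ws = mirror v"
      by blast
    have "mirrors (s # ws @ [s]) = mirror u"
      by (auto simp: mirrors_append ws mirror_v mirror_mirror sU)
    then show ?thesis using ws s by (intro exI[of _ "s # ws @ [s]"]) auto
  qed
qed

text \<open>The exchange condition. Follow the chambers \<open>x, s\<^sub>1 x, s\<^sub>1 s\<^sub>2 x, \<dots>\<close> of the word: the
  hyperplane \<open>v\<close> is crossed at some step, and there the mirror of \<open>v\<close> cancels the letter of this step.
  Formally, \<open>v\<close> is either the first letter or can be pulled through it.\<close>

lemma exchange:
  assumes "\<forall>s\<in>set ws. wall s" "v \<in> U" "aff v x > 0" "aff v (mirrors ws x) < 0"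
  shows "\<exists>ws'. (\<forall>s\<in>set ws'. wall s) \<and> length ws' < length ws \<and> mirror v \<circ> mirrors ws = mirrors ws'"
  using assms
proof (induction ws arbitrary: v)
  case Nil
  then show ?case by simp
next
  case (Cons a as)
  have a: "wall a" "a \<in> U" using Cons.prems by (auto simp: wall_def)
  show ?case
  proof (cases "v = a")
    case True
    then show ?thesis using Cons.prems a
      by (intro exI[of _ as]) (auto simp: mirror_mirror)
  next
    case False
    let ?v = "mirror_root a v"
    have "?v \<in> U" "aff ?v x > 0" "aff ?v (mirrors as x) < 0"
      using Cons.prems a mirror_root_closed mirror_wall_pos False by (auto simp: aff_mirror)
    moreover have "\<forall>s\<in>set as. wall s" using Cons.prems by simp
    ultimately obtain ws' where ws': "\<forall>s\<in>set ws'. wall s"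
      "length ws' < length as" "mirror ?v \<circ> mirrors as = mirrors ws'"
      using Cons.IH[of ?v] by blast
    have "mirror v \<circ> mirrors (a # as) = mirror a \<circ> (mirror ?v \<circ> mirrors as)"
      by (auto simp: mirror_conj a mirror_mirror)
    then have "mirror v \<circ> mirrors (a # as) = mirrors (a # ws')"
      by (simp only: ws' mirrors.simps)
    then show ?thesis using ws'(1,2) a
      by (intro exI[of _ "a # ws'"]) (simp del: mirrors.simps)
  qed
qed

text \<open>A word that returns to its initial chamber crosses the wall of its first letter a second time,
  so the exchange condition shortens it.\<close>

lemma product_of_walls_free:
  assumes "\<forall>s\<in>set ws. wall s" "mirrors ws x = x"
  shows "mirrors ws = id"
  using assms
proof (induction "length ws" arbitrary: ws rule: less_induct)
  case less
  show ?case
  proof (cases ws)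
    case Nil
    then show ?thesis by simp
  next
    case (Cons a as)
    have a: "a \<in> U" "aff a x > 0" using less.prems Cons by (auto simp: wall_def)
    have "aff a x = - aff a (mirrors as x)"
      using less.prems(2) Cons aff_mirror_self[OF a(1), of "mirrors as x"] by simp
    then obtain ws' where "\<forall>s\<in>set ws'. wall s" "length ws' < length as" 
      "mirror a \<circ> mirrors as = mirrors ws'"
      using exchange[of as a] a less.prems Cons by auto
    then show ?thesis using less.hyps[of ws'] less.prems Cons by auto
  qed
qed

theorem mirrors_free:
  assumes "set us \<subseteq> U" "mirrors us x = x"
  shows "mirrors us = id"
proof -
  have "\<exists>ws. (\<forall>s\<in>set ws. wall s) \<and> mirrors ws = mirrors us"
    using assms(1)
  proof (induction us)
    case Nil
    then show ?case by (intro exI[of _ "[]"]) auto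
  next
    case (Cons u us)
    then obtain ws where ws: "\<forall>s\<in>set ws. wall s" "mirrors ws = mirrors us" by auto
    have u: "u \<in> U" using Cons.prems by simp
    have "mirror (- u) = mirror u" by (auto simp: mirror_def)
    moreover have "aff u x > 0 \<or> aff (- u) x > 0" using regular[OF u] by auto
    ultimately obtain vs where "\<forall>s\<in>set vs. wall s" "mirrors vs = mirror u"
      using mirror_is_product_of_walls u uminus_closed by metis
    with ws show ?case by (intro exI[of _ "vs @ ws"]) (auto simp: mirrors_append)
  qed
  then show ?thesis using product_of_walls_free assms(2) by metis
qed

end

section \<open>Indices of lattices\<close>

definition add_subgroup :: "'a::ab_group_add set \<Rightarrow> bool" where
  "add_subgroup A \<longleftrightarrow> 0 \<in> A \<and> (\<forall>x\<in>A. \<forall>y\<in>A. x - y \<in> A)"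

definition cosets :: "'a::ab_group_add set \<Rightarrow> 'a set \<Rightarrow> 'a set set" where
  "cosets A B = (\<lambda>x. (+) x ` B) ` A"

abbreviation idx :: "'a::ab_group_add set \<Rightarrow> 'a set \<Rightarrow> nat" where
  "idx A B \<equiv> card (cosets A B)"

lemma add_subgroupD:
  assumes "add_subgroup A"
  shows "0 \<in> A" "\<And>x y. \<lbrakk>x \<in> A; y \<in> A\<rbrakk> \<Longrightarrow> x - y \<in> A" "\<And>x. x \<in> A \<Longrightarrow> - x \<in> A"
    "\<And>x y. \<lbrakk>x \<in> A; y \<in> A\<rbrakk> \<Longrightarrow> x + y \<in> A"
proof -
  show a: "0 \<in> A" and b: "\<And>x y. \<lbrakk>x \<in> A; y \<in> A\<rbrakk> \<Longrightarrow> x - y \<in> A"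
    using assms by (auto simp: add_subgroup_def)
  show c: "- x \<in> A" if "x \<in> A" for x using b[OF a that] by simp
  show "x + y \<in> A" if "x \<in> A" "y \<in> A" for x y using b[OF that(1) c[OF that(2)]] by simp
qed

lemma add_subgroup_scaleR_int:
  fixes A :: "'a::real_vector set"
  assumes "add_subgroup A" "x \<in> A"
  shows "real_of_int k *\<^sub>R x \<in> A"
proof (induction k rule: int_induct[where k=0])
  case base
  then show ?case using add_subgroupD(1)[OF assms(1)] by simp
next
  case (step1 i)
  then show ?case using add_subgroupD(4)[OF assms(1) step1(2) assms(2)] by (simp add: algebra_simps)
next
  case (step2 i)
  then show ?case using add_subgroupD(2)[OF assms(1) step2(2) assms(2)] by (simp add: algebra_simps)
qed

lemma add_subgroup_sum:
  "add_subgroup A \<Longrightarrow> (\<And>i. i \<in> I \<Longrightarrow> f i \<in> A) \<Longrightarrow> sum f I \<in> A"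
  by (induction I rule: infinite_finite_induct) (auto dest: add_subgroupD)

lemma add_subgroup_scaleR_image:
  fixes A :: "'a::real_vector set"
  assumes "add_subgroup A"
  shows "add_subgroup ((*\<^sub>R) c ` A)"
  unfolding add_subgroup_def
proof (intro conjI ballI)
  show "0 \<in> (*\<^sub>R) c ` A"
    using add_subgroupD(1)[OF assms] by (intro image_eqI[of _ _ 0]) auto
next
  fix x y assume "x \<in> (*\<^sub>R) c ` A" "y \<in> (*\<^sub>R) c ` A"
  then obtain a b where "a \<in> A" "b \<in> A" "x = c *\<^sub>R a" "y = c *\<^sub>R b" by auto
  then show "x - y \<in> (*\<^sub>R) c ` A"
    using add_subgroupD(2)[OF assms]
    by (intro image_eqI[of _ _ "a - b"]) (auto simp: scaleR_diff_right)
qed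

lemma coset_eq_iff:
  assumes "add_subgroup B"
  shows "(+) x ` B = (+) y ` B \<longleftrightarrow> x - y \<in> B"
proof
  assume "(+) x ` B = (+) y ` B"
  then have "x + 0 \<in> (+) y ` B" using add_subgroupD(1)[OF assms] by blast
  then show "x - y \<in> B" by (auto simp: algebra_simps)
next
  assume *: "x - y \<in> B"
  have "(+) x ` B \<subseteq> (+) y ` B" if "x - y \<in> B" for x y
  proof (intro image_subsetI)
    fix b assume "b \<in> B"
    then have "(x - y) + b \<in> B" using that add_subgroupD(4)[OF assms] by blast
    then show "x + b \<in> (+) y ` B" by (intro image_eqI[of _ _ "(x - y) + b"]) auto
  qed
  moreover have "y - x \<in> B" using add_subgroupD(3)[OF assms *] by simp
  ultimately show "(+) x ` B = (+) y ` B" using * by blast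
qed

lemma card_image_eqI:
  assumes "\<And>a b. \<lbrakk>a \<in> A; b \<in> A\<rbrakk> \<Longrightarrow> g a = g b \<longleftrightarrow> h a = h b"
  shows "card (g ` A) = card (h ` A)"
proof (rule bij_betw_same_card)
  have inv: "inv_into A g (g a) \<in> A" "h (inv_into A g (g a)) = h a" if "a \<in> A" for a
    using that assms by (auto intro: inv_into_into) (metis f_inv_into_f imageI inv_into_into)
  show "bij_betw (\<lambda>y. h (inv_into A g y)) (g ` A) (h ` A)"
    using inv assms by (auto simp: bij_betw_def inj_on_def image_image)
qed

text \<open>The form of the isomorphism theorems used here: \<open>f\<close> induces a bijection from \<open>A / B\<close> to
  \<open>A' / B'\<close>.\<close>

lemma idx_cong:
  assumes B: "add_subgroup B" and B': "add_subgroup B'"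
    and f: "\<And>a. a \<in> A \<Longrightarrow> f a \<in> A'"
    and inj: "\<And>a b. \<lbrakk>a \<in> A; b \<in> A\<rbrakk> \<Longrightarrow> f a - f b \<in> B' \<longleftrightarrow> a - b \<in> B"
    and surj: "\<And>c. c \<in> A' \<Longrightarrow> \<exists>a\<in>A. c - f a \<in> B'"
  shows "idx A B = idx A' B'"
proof -
  have "idx A B = card ((\<lambda>a. (+) (f a) ` B') ` A)"
    unfolding cosets_def by (rule card_image_eqI) (simp add: coset_eq_iff B B' inj)
  also have "(\<lambda>a. (+) (f a) ` B') ` A = cosets A' B'"
    using f surj by (auto simp: cosets_def image_iff coset_eq_iff[OF B'])
  finally show ?thesis .
qed

text \<open>A choice of representatives \<open>r\<close> for \<open>A / B\<close> identifies \<open>A / C\<close> with the product of \<open>A / B\<close> and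
  \<open>B / C\<close>.\<close>

lemma idx_tower:
  assumes A: "add_subgroup A" and B: "add_subgroup B" and C: "add_subgroup C"
    and "C \<subseteq> B" "B \<subseteq> A"
  shows "idx A C = idx A B * idx B C"
proof -
  define r where "r K = (SOME x. x \<in> A \<and> (+) x ` B = K)" for K
  have r: "r K \<in> A" "(+) (r K) ` B = K" if "K \<in> cosets A B" for K
    using that someI_ex[of "\<lambda>x. x \<in> A \<and> (+) x ` B = K"] by (auto simp: cosets_def r_def)
  have shift: "(+) a ` (+) b ` C = (+) (a + b) ` C" for a b
    by (simp add: image_image add.assoc)
  have "bij_betw (\<lambda>(K, L). (+) (r K) ` L) (cosets A B \<times> cosets B C) (cosets A C)"
    unfolding bij_betw_def
  proof (intro conjI equalityI subsetI)
    show "inj_on (\<lambda>(K, L). (+) (r K) ` L) (cosets A B \<times> cosets B C)"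
    proof (intro inj_onI, clarify)
      fix K L K' L' assume K: "K \<in> cosets A B" "K' \<in> cosets A B"
        and L: "L \<in> cosets B C" "L' \<in> cosets B C" and eq: "(+) (r K) ` L = (+) (r K') ` L'"
      obtain b b' where b: "b \<in> B" "L = (+) b ` C" "b' \<in> B" "L' = (+) b' ` C"
        using L by (auto simp: cosets_def)
      have d: "r K + b - (r K' + b') \<in> C" using eq by (simp add: b shift coset_eq_iff C)
      then have "r K + b - (r K' + b') - (b - b') \<in> B"
        using b assms add_subgroupD(2)[OF B] by blast
      then have "r K - r K' \<in> B" by (simp add: algebra_simps)
      then have "K = K'" using r K coset_eq_iff[OF B] by metis
      with d have "b - b' \<in> C" by simp
      then show "K = K' \<and> L = L'" using \<open>K = K'\<close> b coset_eq_iff[OF C] by simp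
    qed
  next
    fix M assume "M \<in> (\<lambda>(K, L). (+) (r K) ` L) ` (cosets A B \<times> cosets B C)"
    then obtain K b where K: "K \<in> cosets A B" "b \<in> B" "M = (+) (r K + b) ` C"
      unfolding cosets_def by (auto simp: shift) (metis imageI)
    then have "r K + b \<in> A" using r assms add_subgroupD(4)[OF A] by blast
    then show "M \<in> cosets A C" using K by (simp add: cosets_def)
  next
    fix M assume "M \<in> cosets A C"
    then obtain a where a: "a \<in> A" "M = (+) a ` C" by (auto simp: cosets_def)
    define K where "K = (+) a ` B"
    have K: "K \<in> cosets A B" using a by (simp add: cosets_def K_def)
    then have "a - r K \<in> B" using r[OF K] coset_eq_iff[OF B, of a "r K"] by (simp add: K_def)
    then have "(+) (a - r K) ` C \<in> cosets B C" by (simp add: cosets_def)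
    moreover have "M = (+) (r K) ` (+) (a - r K) ` C" unfolding shift a by simp
    ultimately show "M \<in> (\<lambda>(K, L). (+) (r K) ` L) ` (cosets A B \<times> cosets B C)"
      using K by auto
  qed
  then show ?thesis
    by (metis bij_betw_same_card card_cartesian_product)
qed

lemma idx_pos: "finite (cosets A B) \<Longrightarrow> add_subgroup A \<Longrightarrow> idx A B > 0"
  by (auto simp: card_gt_0_iff cosets_def dest: add_subgroupD)

lemma idx_scaleR:
  fixes A B :: "'a::real_vector set"
  assumes "add_subgroup B" "c \<noteq> 0"
  shows "idx ((*\<^sub>R) c ` A) ((*\<^sub>R) c ` B) = idx A B"
proof (rule idx_cong[symmetric, where f = "(*\<^sub>R) c"])
  show "c *\<^sub>R a - c *\<^sub>R b \<in> (*\<^sub>R) c ` B \<longleftrightarrow> a - b \<in> B" for a b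
    using assms by (auto simp: scaleR_diff_right[symmetric])
  have "0 \<in> (*\<^sub>R) c ` B"
    using add_subgroupD(1)[OF assms(1)] by (intro image_eqI[of _ _ 0]) auto
  then show "\<exists>a\<in>A. d - c *\<^sub>R a \<in> (*\<^sub>R) c ` B" if "d \<in> (*\<^sub>R) c ` A" for d
    using that by (metis (no_types, lifting) diff_self imageE)
qed (use assms add_subgroup_scaleR_image in auto)

text \<open>Pigeonhole: among the first multiples of \<open>a\<close> two agree modulo \<open>B\<close>, so a number that is at most
  the index kills \<open>a\<close>, and the factorial of the index kills everything.\<close>

lemma finite_cosets_exponent:
  fixes A B :: "'a::real_vector set"
  assumes A: "add_subgroup A" and B: "add_subgroup B" and fin: "finite (cosets A B)"
  shows "\<exists>m>0. \<forall>a\<in>A. real m *\<^sub>R a \<in> B"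
proof (intro exI[of _ "fact (idx A B)"] conjI ballI)
  fix a assume a: "a \<in> A"
  let ?n = "idx A B"
  define h where "h k = (+) (real k *\<^sub>R a) ` B" for k :: nat
  have "real k *\<^sub>R a \<in> A" for k using add_subgroup_scaleR_int[OF A a, of "int k"] by simp
  then have "h ` {0..?n} \<subseteq> cosets A B" by (auto simp: h_def cosets_def)
  then have "card (h ` {0..?n}) \<le> ?n" using fin by (intro card_mono) auto
  then have "\<not> inj_on h {0..?n}" using card_image[of h "{0..?n}"] by auto
  then obtain i j where "i \<le> ?n" "j \<le> ?n" "i \<noteq> j" "h i = h j" by (auto simp: inj_on_def)
  then obtain i j where ij: "i < j" "j \<le> ?n" "h j = h i"
    by (metis linorder_neqE_nat)
  then have "real j *\<^sub>R a - real i *\<^sub>R a \<in> B" by (simp add: h_def coset_eq_iff B)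
  then have d: "real (j - i) *\<^sub>R a \<in> B" using ij by (simp add: of_nat_diff scaleR_diff_left)
  have "j - i dvd fact ?n" using ij by (intro dvd_fact) auto
  then obtain k where k: "fact ?n = (j - i) * k" by blast
  have "real (fact ?n) *\<^sub>R a = real_of_int (int k) *\<^sub>R (real (j - i) *\<^sub>R a)"
    unfolding k by (simp add: mult.commute)
  then show "real (fact ?n) *\<^sub>R a \<in> B" using add_subgroup_scaleR_int[OF B d] by metis
qed simp

definition zspan :: "'a::real_vector set \<Rightarrow> 'a set" where
  "zspan J = range (\<lambda>c. \<Sum>j\<in>J. real_of_int (c j) *\<^sub>R j)"

lemma zspanI: "(\<Sum>j\<in>J. real_of_int (c j) *\<^sub>R j) \<in> zspan J"
  by (simp add: zspan_def)

lemma add_subgroup_zspan: "add_subgroup (zspan J)"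
proof -
  have "0 \<in> zspan J" using zspanI[of "\<lambda>_. 0" J] by simp
  moreover have "x - y \<in> zspan J" if xy: "x \<in> zspan J" "y \<in> zspan J" for x y
  proof -
    obtain c d where "x = (\<Sum>j\<in>J. real_of_int (c j) *\<^sub>R j)" "y = (\<Sum>j\<in>J. real_of_int (d j) *\<^sub>R j)"
      using xy by (auto simp: zspan_def)
    then have "x - y = (\<Sum>j\<in>J. real_of_int (c j - d j) *\<^sub>R j)"
      by (simp add: sum_subtractf scaleR_diff_left)
    then show ?thesis using zspanI by metis
  qed
  ultimately show ?thesis by (simp add: add_subgroup_def)
qed

lemma zspan_subset: "add_subgroup A \<Longrightarrow> J \<subseteq> A \<Longrightarrow> zspan J \<subseteq> A"
  by (auto simp: zspan_def intro!: add_subgroup_sum add_subgroup_scaleR_int)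

text \<open>Subtracting integer parts of coefficients moves any point of \<open>Y\<close> into a fundamental
  parallelepiped of \<open>J\<close>. The functionals in \<open>B\<close> take bounded integer values there and separate points,
  so only finitely many points of \<open>Y\<close> remain. The functionals take the role of a discreteness
  assumption on \<open>Y\<close>.\<close>

lemma finite_cosets_zspan:
  fixes Y :: "'a::euclidean_space set"
  assumes Y: "add_subgroup Y" and J: "finite J" "J \<subseteq> Y" "Y \<subseteq> span J"
    and B: "finite B" "\<And>b y. \<lbrakk>b \<in> B; y \<in> Y\<rbrakk> \<Longrightarrow> b \<bullet> y \<in> \<int>"
    and sep: "\<And>v. \<lbrakk>v \<in> span J; \<And>b. b \<in> B \<Longrightarrow> b \<bullet> v = 0\<rbrakk> \<Longrightarrow> v = 0"
  shows "finite (cosets Y (zspan J))"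
proof -
  define K where "K b = (\<Sum>j\<in>J. \<bar>b \<bullet> j\<bar>)" for b
  define P where "P = {r \<in> Y. \<forall>b\<in>B. \<bar>b \<bullet> r\<bar> \<le> K b}"
  have "inj_on (\<lambda>r. restrict (\<lambda>b. b \<bullet> r) B) P"
  proof (intro inj_onI)
    fix r s assume rs: "r \<in> P" "s \<in> P"
      and eq: "restrict (\<lambda>b. b \<bullet> r) B = restrict (\<lambda>b. b \<bullet> s) B"
    have "b \<bullet> (r - s) = 0" if "b \<in> B" for b
      using fun_cong[OF eq, of b] that by (simp add: inner_diff_right)
    moreover have "r - s \<in> span J" using rs J by (auto simp: P_def intro!: span_diff)
    ultimately show "r = s" using sep[of "r - s"] by simp
  qed
  moreover have "(\<lambda>r. restrict (\<lambda>b. b \<bullet> r) B) ` P \<subseteq> (\<Pi>\<^sub>E b\<in>B. {z \<in> \<int>. - K b \<le> z \<and> z \<le> K b})"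
    using B(2) by (auto simp: P_def abs_le_iff)
  then have "finite ((\<lambda>r. restrict (\<lambda>b. b \<bullet> r) B) ` P)"
    by (rule finite_subset) (intro finite_PiE B finite_int_segment)
  ultimately have "finite P" by (simp add: finite_image_iff)
  moreover have "cosets Y (zspan J) \<subseteq> (\<lambda>x. (+) x ` zspan J) ` P"
  proof -
    have "\<exists>r\<in>P. (+) y ` zspan J = (+) r ` zspan J" if y: "y \<in> Y" for y
    proof -
      obtain c where c: "y = (\<Sum>j\<in>J. c j *\<^sub>R j)"
        using J y by (auto simp: span_finite)
      define z where "z = (\<Sum>j\<in>J. real_of_int \<lfloor>c j\<rfloor> *\<^sub>R j)"
      have z: "z \<in> zspan J" unfolding z_def by (rule zspanI)
      have "y - z = (\<Sum>j\<in>J. frac (c j) *\<^sub>R j)"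
        by (simp add: c z_def sum_subtractf[symmetric] scaleR_diff_left[symmetric] frac_def)
      then have "\<bar>b \<bullet> (y - z)\<bar> \<le> (\<Sum>j\<in>J. \<bar>frac (c j) * (b \<bullet> j)\<bar>)" for b
        by (simp add: inner_sum_right sum_abs)
      also have "(\<Sum>j\<in>J. \<bar>frac (c j) * (b \<bullet> j)\<bar>) \<le> K b" for b
        unfolding K_def
        by (intro sum_mono) (simp add: abs_mult frac_lt_1 less_imp_le mult_left_le_one_le)
      finally have "y - z \<in> P"
        using y z zspan_subset[OF Y J(2)] add_subgroupD(2)[OF Y] by (auto simp: P_def)
      moreover have "(+) y ` zspan J = (+) (y - z) ` zspan J"
        using z by (simp add: coset_eq_iff add_subgroup_zspan)
      ultimately show ?thesis by blast
    qed
    then show ?thesis unfolding cosets_def by blast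
  qed
  ultimately show ?thesis by (meson finite_imageI finite_subset)
qed

lemma idx_zspan_scaleR:
  fixes J :: "'a::euclidean_space set"
  assumes J: "independent J" and q: "q > 0"
  shows "idx (zspan J) ((*\<^sub>R) (real q) ` zspan J) = q ^ card J"
proof -
  let ?l = "\<lambda>c. \<Sum>j\<in>J. real_of_int (c j) *\<^sub>R j"
  let ?Q = "(*\<^sub>R) (real q) ` zspan J"
  let ?C = "J \<rightarrow>\<^sub>E {0..<int q}"
  have fin: "finite J" using J by (rule independent_imp_finite)
  have Q: "add_subgroup ?Q" by (intro add_subgroup_scaleR_image add_subgroup_zspan)
  have diff: "?l c - ?l d \<in> ?Q \<longleftrightarrow> (\<forall>j\<in>J. [c j = d j] (mod int q))" for c d
  proof
    assume "?l c - ?l d \<in> ?Q"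
    then obtain e where "?l c - ?l d = real q *\<^sub>R ?l e" by (auto simp: zspan_def)
    then have "(\<Sum>j\<in>J. (real_of_int (c j) - real_of_int (d j) - real q * real_of_int (e j)) *\<^sub>R j) = 0"
      by (simp add: scaleR_diff_left sum_subtractf scaleR_sum_right)
    from independentD[OF J fin order_refl this]
    have "c j - d j = int q * e j" if "j \<in> J" for j
      using that by (metis eq_iff_diff_eq_0 of_int_diff of_int_eq_iff of_int_mult of_int_of_nat_eq)
    then show "\<forall>j\<in>J. [c j = d j] (mod int q)" by (simp add: cong_iff_dvd_diff)
  next
    assume "\<forall>j\<in>J. [c j = d j] (mod int q)"
    then have "\<forall>j\<in>J. \<exists>k. c j - d j = int q * k" by (simp add: cong_iff_dvd_diff dvd_def)
    then obtain e where e: "\<And>j. j \<in> J \<Longrightarrow> c j - d j = int q * e j" by metis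
    have "?l c - ?l d = (\<Sum>j\<in>J. real_of_int (c j - d j) *\<^sub>R j)"
      by (simp add: sum_subtractf scaleR_diff_left)
    also have "\<dots> = real q *\<^sub>R ?l e"
      unfolding scaleR_sum_right by (intro sum.cong refl) (simp only: e of_int_mult of_int_of_nat_eq scaleR_scaleR)
    finally show "?l c - ?l d \<in> ?Q" using zspanI[of e J] by auto
  qed
  have "cosets (zspan J) ?Q = (\<lambda>c. (+) (?l c) ` ?Q) ` ?C"
  proof -
    have "\<exists>d\<in>?C. (+) (?l c) ` ?Q = (+) (?l d) ` ?Q" for c
      using q by (intro bexI[of _ "restrict (\<lambda>j. c j mod int q) J"])
        (simp_all only: coset_eq_iff[OF Q] diff, auto simp: cong_def)
    then show ?thesis unfolding cosets_def zspan_def image_image by blast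
  qed
  moreover have "inj_on (\<lambda>c. (+) (?l c) ` ?Q) ?C"
  proof (intro inj_onI)
    fix c d assume cd: "c \<in> ?C" "d \<in> ?C" and "(+) (?l c) ` ?Q = (+) (?l d) ` ?Q"
    then have "\<forall>j\<in>J. [c j = d j] (mod int q)" unfolding coset_eq_iff[OF Q] diff by simp
    moreover have "0 \<le> c j \<and> c j < int q \<and> 0 \<le> d j \<and> d j < int q" if "j \<in> J" for j
      using cd that by (auto simp: PiE_iff)
    ultimately have "c j = d j" if "j \<in> J" for j using that by (auto simp: cong_def)
    then show "c = d" using cd by (auto intro: PiE_ext)
  qed
  ultimately show ?thesis by (simp add: card_image card_PiE fin)
qed

text \<open>It suffices to find in \<open>Y\<close> one sublattice of finite index with a basis \<open>J\<close>, for which the index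
  is evident: the chains from \<open>Y\<close> down to \<open>q J\<close> through \<open>J\<close> and through \<open>q Y\<close> give the same product, and
  the index of \<open>q J\<close> in \<open>q Y\<close> is that of \<open>J\<close> in \<open>Y\<close>. In this way no basis of \<open>Y\<close> is needed.\<close>

theorem idx_scaleR_lattice:
  fixes Y :: "'a::euclidean_space set"
  assumes Y: "add_subgroup Y" and q: "q > 0"
    and B: "finite B" "\<And>b y. \<lbrakk>b \<in> B; y \<in> Y\<rbrakk> \<Longrightarrow> b \<bullet> y \<in> \<int>"
    and sep: "\<And>v. \<lbrakk>v \<in> span Y; \<And>b. b \<in> B \<Longrightarrow> b \<bullet> v = 0\<rbrakk> \<Longrightarrow> v = 0"
  shows "idx Y ((*\<^sub>R) (real q) ` Y) = q ^ dim Y"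
proof -
  obtain J where J: "J \<subseteq> Y" "independent J" "Y \<subseteq> span J" "card J = dim Y"
    using basis_exists by metis
  let ?q = "(*\<^sub>R) (real q)"
  have fin: "finite J" using J by (simp add: independent_imp_finite)
  have "span J \<subseteq> span Y" using J by (simp add: span_mono)
  then have "finite (cosets Y (zspan J))"
    using finite_cosets_zspan[OF Y fin J(1,3) B] sep by blast
  then have pos: "idx Y (zspan J) > 0" using Y by (rule idx_pos)
  have ZY: "zspan J \<subseteq> Y" using zspan_subset[OF Y J(1)] .
  have sub: "add_subgroup (zspan J)" "add_subgroup (?q ` zspan J)" "add_subgroup (?q ` Y)"
    by (intro add_subgroup_zspan add_subgroup_scaleR_image Y)+
  have scale_sub: "?q ` A \<subseteq> A" if "add_subgroup A" for A :: "'a set"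
    using add_subgroup_scaleR_int[OF that, of _ "int q"] by auto
  have "idx Y (?q ` Y) * idx (?q ` Y) (?q ` zspan J) = idx Y (?q ` zspan J)"
    using ZY scale_sub Y sub by (intro idx_tower[symmetric]) auto
  also have "\<dots> = idx Y (zspan J) * idx (zspan J) (?q ` zspan J)"
    using ZY scale_sub Y sub by (intro idx_tower) auto
  also have "idx (?q ` Y) (?q ` zspan J) = idx Y (zspan J)"
    using q by (intro idx_scaleR sub) auto
  finally show ?thesis using pos by (simp add: idx_zspan_scaleR J q)
qed

section \<open>Torsion points on intersections of root hyperplanes\<close>

definition perp :: "'a::euclidean_space set \<Rightarrow> 'a set" where
  "perp B = {x. \<forall>\<beta>\<in>B. \<beta> \<bullet> x = 0}"

definition dual :: "'a::euclidean_space set \<Rightarrow> 'a set" where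
  "dual B = {x. \<forall>\<beta>\<in>B. \<beta> \<bullet> x \<in> \<int>}"

definition sumset :: "'a::ab_group_add set \<Rightarrow> 'a set \<Rightarrow> 'a set" where
  "sumset A B = {a + b | a b. a \<in> A \<and> b \<in> B}"

lemma add_subgroup_dual: "add_subgroup (dual B)"
  by (auto simp: add_subgroup_def dual_def inner_diff_right)

lemma add_subgroup_perp: "add_subgroup (perp B)"
  by (auto simp: add_subgroup_def perp_def inner_diff_right)

lemma subspace_perp: "subspace (perp B)"
  by (auto simp: subspace_def perp_def inner_right_distrib)

lemma perp_subset_dual: "perp B \<subseteq> dual B"
  by (auto simp: perp_def dual_def)

lemma add_subgroup_Int: "add_subgroup A \<Longrightarrow> add_subgroup B \<Longrightarrow> add_subgroup (A \<inter> B)"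
  by (auto simp: add_subgroup_def)

lemma add_subgroup_sumset:
  assumes A: "add_subgroup A" and B: "add_subgroup B"
  shows "add_subgroup (sumset A B)"
  unfolding add_subgroup_def
proof (intro conjI ballI)
  have "0 + 0 \<in> sumset A B"
    using add_subgroupD(1)[OF A] add_subgroupD(1)[OF B] unfolding sumset_def by blast
  then show "0 \<in> sumset A B" by simp
next
  fix x y assume "x \<in> sumset A B" "y \<in> sumset A B"
  then obtain a b c d where *: "a \<in> A" "b \<in> B" "c \<in> A" "d \<in> B" "x = a + b" "y = c + d"
    by (auto simp: sumset_def)
  then have "x - y = (a - c) + (b - d)" by simp
  then show "x - y \<in> sumset A B"
    using * add_subgroupD(2)[OF A] add_subgroupD(2)[OF B] unfolding sumset_def by blast
qed

lemma sumsetI: "a \<in> A \<Longrightarrow> b \<in> B \<Longrightarrow> a + b \<in> sumset A B"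
  unfolding sumset_def by blast

lemma sumset_left: "add_subgroup B \<Longrightarrow> A \<subseteq> sumset A B"
  using sumsetI[of _ A 0 B] by (auto dest: add_subgroupD(1))

lemma sumset_right: "add_subgroup A \<Longrightarrow> B \<subseteq> sumset A B"
  using sumsetI[of 0 A _ B] by (auto dest: add_subgroupD(1))

lemma sumset_subset: "add_subgroup C \<Longrightarrow> A \<subseteq> C \<Longrightarrow> B \<subseteq> C \<Longrightarrow> sumset A B \<subseteq> C"
  by (auto simp: sumset_def intro: add_subgroupD(4))

lemma orthogonal_span_zero:
  assumes "v \<in> span B" "\<And>b. b \<in> B \<Longrightarrow> b \<bullet> v = (0::real)"
  shows "v = 0"
proof -
  have "orthogonal v v"
    by (rule orthogonal_to_span[OF assms(1)]) (use assms(2) in \<open>simp add: orthogonal_def inner_commute\<close>)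
  then show ?thesis by (simp add: orthogonal_def)
qed

locale root_sys =
  fixes \<Phi> :: "'a::euclidean_space set"
  assumes root_system: "root_system \<Phi>"
begin

abbreviation Z where "Z \<equiv> coweight_lattice \<Phi>"

lemma finite_roots: "finite \<Phi>"
  and root_nonzero: "\<beta> \<in> \<Phi> \<Longrightarrow> \<beta> \<noteq> 0"
  and span_roots: "span \<Phi> = UNIV"
  and reflection_root: "\<alpha> \<in> \<Phi> \<Longrightarrow> \<beta> \<in> \<Phi> \<Longrightarrow> reflection \<alpha> \<beta> \<in> \<Phi>"
  and cartan_integer: "\<alpha> \<in> \<Phi> \<Longrightarrow> \<beta> \<in> \<Phi> \<Longrightarrow> \<beta> \<bullet> coroot \<alpha> \<in> \<int>"
  using root_system by (auto simp: root_system_def)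

lemma zero_not_root: "0 \<notin> \<Phi>"
  using root_nonzero by blast

lemma Z_dual: "Z = dual \<Phi>"
  by (simp add: coweight_lattice_def dual_def)

lemma add_subgroup_Z: "add_subgroup Z"
  by (simp add: Z_dual add_subgroup_dual)

lemma coroot_in_Z: "\<beta> \<in> \<Phi> \<Longrightarrow> coroot \<beta> \<in> Z"
  by (simp add: coweight_lattice_def cartan_integer)

lemma Z_subset_dual: "B \<subseteq> \<Phi> \<Longrightarrow> Z \<subseteq> dual B"
  by (auto simp: Z_dual dual_def)

lemma span_coroots:
  assumes "B \<subseteq> \<Phi>" shows "span (coroot ` B) = span B"
proof (intro equalityI span_minimal subspace_span subsetI)
  fix v assume "v \<in> coroot ` B"
  then show "v \<in> span B" by (auto simp: coroot_def intro: span_scale span_base)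
next
  fix b assume b: "b \<in> B"
  then have "b = ((b \<bullet> b) / 2) *\<^sub>R coroot b"
    using assms root_nonzero by (auto simp: coroot_def)
  then show "b \<in> span (coroot ` B)"
    using b by (metis imageI span_base span_scale)
qed

lemma span_Z: "span Z = UNIV"
  using span_coroots[of \<Phi>] span_roots span_mono[of "coroot ` \<Phi>" Z] coroot_in_Z by auto

text \<open>The coroots of \<open>B\<close> generate a subgroup of finite index in the lattice of all vectors in the span
  of \<open>B\<close> on which \<open>B\<close> is integral, and they are coweights.\<close>

lemma ex_span_exponent:
  assumes B: "B \<subseteq> \<Phi>"
  shows "\<exists>m>0. \<forall>v\<in>span B \<inter> dual B. real m *\<^sub>R v \<in> Z"
proof -
  let ?Y = "span B \<inter> dual B" and ?J = "coroot ` B"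
  have finB: "finite B" using B finite_roots finite_subset by blast
  have Y: "add_subgroup ?Y"
    by (intro add_subgroup_Int add_subgroup_dual) (auto simp: add_subgroup_def span_diff span_zero)
  have JZ: "?J \<subseteq> Z" using B coroot_in_Z by auto
  then have J: "?J \<subseteq> ?Y" using Z_subset_dual[OF B] span_coroots[OF B] span_superset[of ?J] by auto
  have "finite (cosets ?Y (zspan ?J))"
    using J finB span_coroots[OF B] orthogonal_span_zero[of _ B]
    by (intro finite_cosets_zspan[where B = B] Y) (auto simp: dual_def)
  then obtain m where m: "m > 0" "\<forall>v\<in>?Y. real m *\<^sub>R v \<in> zspan ?J"
    using finite_cosets_exponent[OF Y add_subgroup_zspan] by blast
  then show ?thesis using zspan_subset[OF add_subgroup_Z JZ] by (intro exI[of _ m]) auto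
qed

lemma decompose:
  obtains v u where "v \<in> span B" "u \<in> perp B" "x = v + u"
proof -
  obtain v u where *: "v \<in> span B" "\<And>w. w \<in> span B \<Longrightarrow> orthogonal u w" "x = v + u"
    using orthogonal_subspace_decomp_exists[of B x] by metis
  then have "u \<in> perp B" by (auto simp: perp_def orthogonal_def span_base inner_commute)
  with * show thesis using that by blast
qed

text \<open>The group \<open>dual B / (perp B + Z)\<close> is the component group of the closed subgroup \<open>dual B / Z\<close> of
  the torus \<open>E / Z\<close>. It has finite exponent.\<close>

lemma ex_dual_exponent:
  assumes B: "B \<subseteq> \<Phi>"
  shows "\<exists>m>0. \<forall>d\<in>dual B. real m *\<^sub>R d \<in> sumset (perp B) Z"
proof -
  obtain m where m: "m > 0" "\<forall>v\<in>span B \<inter> dual B. real m *\<^sub>R v \<in> Z"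
    using ex_span_exponent[OF B] by blast
  have "real m *\<^sub>R d \<in> sumset (perp B) Z" if d: "d \<in> dual B" for d
  proof -
    obtain v u where vu: "v \<in> span B" "u \<in> perp B" "d = v + u" by (rule decompose)
    then have "v = d - u" by simp
    then have "v \<in> dual B"
      using d vu add_subgroupD(2)[OF add_subgroup_dual] perp_subset_dual by blast
    then have "real m *\<^sub>R u + real m *\<^sub>R v \<in> sumset (perp B) Z"
      using vu m \<open>v \<in> dual B\<close> subspace_scale[OF subspace_perp] by (intro sumsetI) auto
    then show ?thesis by (simp add: vu algebra_simps)
  qed
  then show ?thesis using m by blast
qed

text \<open>The subspace \<open>perp B\<close> is rational: a fixed multiple of the orthogonal projection to it
  maps coweights to coweights, and coweights span the whole space.\<close>

lemma dim_Z_perp: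
  assumes B: "B \<subseteq> \<Phi>"
  shows "dim (Z \<inter> perp B) = dim (perp B)"
proof -
  let ?Y = "Z \<inter> perp B"
  have sub: "span ?Y \<subseteq> perp B" by (intro span_minimal subspace_perp) auto
  obtain m where m: "m > 0" "\<forall>v\<in>span B \<inter> dual B. real m *\<^sub>R v \<in> Z"
    using ex_span_exponent[OF B] by blast
  have "z \<in> sumset (span B) (span ?Y)" if z: "z \<in> Z" for z
  proof -
    obtain v u where vu: "v \<in> span B" "u \<in> perp B" "z = v + u" by (rule decompose)
    then have "v = z - u" by simp
    then have "v \<in> dual B"
      using z vu add_subgroupD(2)[OF add_subgroup_dual] perp_subset_dual Z_subset_dual[OF B] by blast
    then have "real m *\<^sub>R v \<in> Z" using m vu by simp
    moreover have "real m *\<^sub>R z \<in> Z" using add_subgroup_scaleR_int[OF add_subgroup_Z z, of "int m"] by simp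
    ultimately have "real m *\<^sub>R z - real m *\<^sub>R v \<in> Z" by (rule add_subgroupD(2)[OF add_subgroup_Z, rotated])
    then have "real m *\<^sub>R u \<in> ?Y" using vu by (simp add: algebra_simps subspace_scale[OF subspace_perp])
    then have "inverse (real m) *\<^sub>R (real m *\<^sub>R u) \<in> span ?Y" by (intro span_scale span_base)
    then have "u \<in> span ?Y" using m by simp
    then show ?thesis using vu by (auto simp: sumset_def)
  qed
  then have "span Z \<subseteq> sumset (span B) (span ?Y)"
    unfolding sumset_def by (intro span_minimal subspace_sums subspace_span) (auto simp: sumset_def)
  then have all: "x \<in> sumset (span B) (span ?Y)" for x using span_Z by auto
  have "perp B \<subseteq> span ?Y"
  proof
    fix x assume x: "x \<in> perp B"
    obtain v y where vy: "v \<in> span B" "y \<in> span ?Y" "x = v + y"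
      using all[of x] by (auto simp: sumset_def)
    then have "v = x - y" by simp
    then have "v \<in> perp B" using vy x sub subspace_perp subspace_diff by blast
    then have "v = 0" using vy orthogonal_span_zero[of v B] by (auto simp: perp_def)
    then show "x \<in> span ?Y" using vy by simp
  qed
  then show ?thesis using sub by (metis dim_span equalityI)
qed

definition div_lattice :: "'a set \<Rightarrow> nat \<Rightarrow> 'a set" where
  "div_lattice B q = {z \<in> Z. \<forall>\<beta>\<in>B. (\<beta> \<bullet> z) / real q \<in> \<int>}"

text \<open>The number of \<open>q\<close>-torsion elements of the component group of \<open>dual B / Z\<close>.\<close>

definition component_torsion :: "'a set \<Rightarrow> nat \<Rightarrow> nat" where
  "component_torsion B q =
     idx {d \<in> dual B. real q *\<^sub>R d \<in> sumset (perp B) Z} (sumset (perp B) Z)"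

lemma scaled_subset: "scaled_coweight_lattice \<Phi> q \<subseteq> Z"
  using add_subgroup_scaleR_int[OF add_subgroup_Z, of _ "int q"]
  by (auto simp: scaled_coweight_lattice_def)

lemma add_subgroup_scaled: "add_subgroup (scaled_coweight_lattice \<Phi> q)"
  unfolding scaled_coweight_lattice_def by (intro add_subgroup_scaleR_image add_subgroup_Z)

text \<open>Division by \<open>q\<close> turns the left-hand side into the number of \<open>q\<close>-torsion points of \<open>dual B / Z\<close>.
  The intermediate lattice \<open>mid\<close> consists of the points that land in the identity component
  \<open>(perp B + Z) / Z\<close>. This component contributes \<open>q ^ dim (perp B)\<close>, and since it is divisible, each
  torsion element of the component group lifts to a torsion point.\<close>

lemma idx_div_lattice:
  assumes B: "B \<subseteq> \<Phi>" and q: "q > 0"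
  shows "idx (div_lattice B q) (scaled_coweight_lattice \<Phi> q) = q ^ dim (perp B) * component_torsion B q"
proof -
  let ?qZ = "scaled_coweight_lattice \<Phi> q"
  let ?D = "{d \<in> dual B. real q *\<^sub>R d \<in> sumset (perp B) Z}"
  define Y where "Y = Z \<inter> perp B"
  define mid where "mid = sumset Y ?qZ"
  define X where "X = sumset (perp B) Z"
  have Y: "add_subgroup Y" unfolding Y_def by (intro add_subgroup_Int add_subgroup_Z add_subgroup_perp)
  have mid: "add_subgroup mid" unfolding mid_def by (intro add_subgroup_sumset Y add_subgroup_scaled)
  have X: "add_subgroup X" unfolding X_def by (intro add_subgroup_sumset add_subgroup_perp add_subgroup_Z)
  have div: "add_subgroup (div_lattice B q)"
    using add_subgroup_Z by (auto simp: add_subgroup_def div_lattice_def inner_diff_right diff_divide_distrib)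
  have div_iff: "z \<in> div_lattice B q \<longleftrightarrow> z \<in> Z \<and> inverse (real q) *\<^sub>R z \<in> dual B" for z
    by (simp add: div_lattice_def dual_def field_simps)
  have "?qZ \<subseteq> div_lattice B q"
  proof
    fix z assume z: "z \<in> ?qZ"
    then obtain y where "y \<in> Z" "z = real q *\<^sub>R y" by (auto simp: scaled_coweight_lattice_def)
    then show "z \<in> div_lattice B q"
      using z scaled_subset[of q] Z_subset_dual[OF B] q by (auto simp: div_iff)
  qed
  moreover have "Y \<subseteq> div_lattice B q" by (auto simp: Y_def div_lattice_def perp_def)
  ultimately have "mid \<subseteq> div_lattice B q" unfolding mid_def by (intro sumset_subset div)
  moreover have qmid: "?qZ \<subseteq> mid" unfolding mid_def by (rule sumset_right[OF Y])
  ultimately have "idx (div_lattice B q) ?qZ = idx (div_lattice B q) mid * idx mid ?qZ"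
    by (intro idx_tower div mid add_subgroup_scaled)
  also have "idx mid ?qZ = q ^ dim (perp B)"
  proof -
    have "idx Y ((*\<^sub>R) (real q) ` Y) = idx mid ?qZ"
    proof (rule idx_cong[where f = id])
      show "id a \<in> mid" if "a \<in> Y" for a
        using that sumset_left[OF add_subgroup_scaled] by (auto simp: mid_def)
      show "id a - id b \<in> ?qZ \<longleftrightarrow> a - b \<in> (*\<^sub>R) (real q) ` Y" if ab: "a \<in> Y" "b \<in> Y" for a b
      proof -
        have "y \<in> perp B" if "real q *\<^sub>R y = a - b" for y
        proof -
          have "a - b \<in> perp B" using add_subgroupD(2)[OF Y ab] by (simp add: Y_def)
          then have "real q *\<^sub>R y \<in> perp B" using that by simp
          then show ?thesis using q by (simp add: perp_def)
        qed
        then show ?thesis by (auto simp: scaled_coweight_lattice_def Y_def)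
      qed
      show "\<exists>a\<in>Y. c - id a \<in> ?qZ" if "c \<in> mid" for c
      proof -
        obtain a b where "a \<in> Y" "b \<in> ?qZ" "c = a + b" using \<open>c \<in> mid\<close> by (auto simp: mid_def sumset_def)
        then show ?thesis by (intro bexI[of _ a]) auto
      qed
    qed (intro add_subgroup_scaleR_image Y add_subgroup_scaled)+
    moreover have "idx Y ((*\<^sub>R) (real q) ` Y) = q ^ dim Y"
    proof (rule idx_scaleR_lattice[OF Y q finite_roots])
      show "\<beta> \<bullet> y \<in> \<int>" if "\<beta> \<in> \<Phi>" "y \<in> Y" for \<beta> y
        using that by (auto simp: Y_def coweight_lattice_def)
      show "v = 0" if "\<And>\<beta>. \<beta> \<in> \<Phi> \<Longrightarrow> \<beta> \<bullet> v = 0" for v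
        using orthogonal_span_zero[of v \<Phi>] span_roots that by simp
    qed
    ultimately show ?thesis using dim_Z_perp[OF B] by (simp add: Y_def)
  qed
  also have "idx (div_lattice B q) mid = idx ?D X"
  proof (rule idx_cong[where f = "(*\<^sub>R) (inverse (real q))"])
    show "inverse (real q) *\<^sub>R a \<in> ?D" if "a \<in> div_lattice B q" for a
      using that q sumset_right[OF add_subgroup_perp] by (auto simp: div_iff)
    show "inverse (real q) *\<^sub>R a - inverse (real q) *\<^sub>R b \<in> X \<longleftrightarrow> a - b \<in> mid"
      if ab: "a \<in> div_lattice B q" "b \<in> div_lattice B q" for a b
    proof -
      have abZ: "a - b \<in> Z" using ab add_subgroupD(2)[OF add_subgroup_Z] by (auto simp: div_iff)
      have "inverse (real q) *\<^sub>R (a - b) \<in> X \<longleftrightarrow> a - b \<in> mid"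
      proof
        assume "inverse (real q) *\<^sub>R (a - b) \<in> X"
        then obtain u z where uz: "u \<in> perp B" "z \<in> Z" "inverse (real q) *\<^sub>R (a - b) = u + z"
          by (auto simp: X_def sumset_def)
        have "real q *\<^sub>R inverse (real q) *\<^sub>R (a - b) = real q *\<^sub>R u + real q *\<^sub>R z"
          unfolding uz by (simp add: scaleR_add_right)
        then have eq: "a - b = real q *\<^sub>R u + real q *\<^sub>R z" using q by simp
        have qz: "real q *\<^sub>R z \<in> ?qZ" using uz by (auto simp: scaled_coweight_lattice_def)
        have "real q *\<^sub>R u = (a - b) - real q *\<^sub>R z" using eq by simp
        then have "real q *\<^sub>R u \<in> Z" using add_subgroupD(2)[OF add_subgroup_Z abZ subsetD[OF scaled_subset qz]] by simp
        then have "real q *\<^sub>R u \<in> Y" using uz by (auto simp: Y_def subspace_scale[OF subspace_perp])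
        then show "a - b \<in> mid" unfolding eq mid_def using qz by (intro sumsetI)
      next
        assume "a - b \<in> mid"
        then obtain y z where yz: "y \<in> Y" "z \<in> Z" "a - b = y + real q *\<^sub>R z"
          by (auto simp: mid_def sumset_def scaled_coweight_lattice_def)
        have "inverse (real q) *\<^sub>R (a - b) = inverse (real q) *\<^sub>R y + z"
          unfolding yz using q by (simp add: scaleR_add_right)
        then show "inverse (real q) *\<^sub>R (a - b) \<in> X"
          using yz by (auto simp: X_def Y_def subspace_scale[OF subspace_perp] intro!: sumsetI)
      qed
      then show ?thesis by (simp add: scaleR_diff_right)
    qed
    show "\<exists>a\<in>div_lattice B q. c - inverse (real q) *\<^sub>R a \<in> X" if c: "c \<in> ?D" for c
    proof -
      obtain u z where uz: "u \<in> perp B" "z \<in> Z" "real q *\<^sub>R c = u + z"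
        using c by (auto simp: sumset_def)
      let ?u = "inverse (real q) *\<^sub>R u"
      have "inverse (real q) *\<^sub>R real q *\<^sub>R c = ?u + inverse (real q) *\<^sub>R z"
        unfolding uz by (simp add: scaleR_add_right)
      then have eq: "c - inverse (real q) *\<^sub>R z = ?u" using q by simp
      have u: "?u \<in> perp B" using uz by (simp add: subspace_scale[OF subspace_perp])
      have "inverse (real q) *\<^sub>R z = c - ?u" using eq by (simp add: algebra_simps)
      moreover have "c - ?u \<in> dual B"
        using c by (intro add_subgroupD(2)[OF add_subgroup_dual] subsetD[OF perp_subset_dual u]) auto
      ultimately have "inverse (real q) *\<^sub>R z \<in> dual B" by (simp only:)
      moreover have "?u \<in> X" using u sumset_left[OF add_subgroup_Z] by (auto simp: X_def)
      ultimately show ?thesis using uz eq by (intro bexI[of _ z]) (auto simp: div_iff)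
    qed
  qed (intro mid X)+
  finally show ?thesis by (simp add: component_torsion_def X_def mult.commute)
qed

text \<open>Multiplication by \<open>q\<close> on the component group depends only on \<open>q\<close> modulo the exponent, and is
  injective if \<open>q\<close> is coprime to it.\<close>

lemma component_torsion_periodic:
  assumes B: "B \<subseteq> \<Phi>"
  shows "\<exists>m>0. (\<forall>q r. [q = r] (mod m) \<longrightarrow> component_torsion B q = component_torsion B r) \<and>
               (\<forall>q. coprime q m \<longrightarrow> component_torsion B q = 1)"
proof -
  let ?X = "sumset (perp B) Z"
  have X: "add_subgroup ?X" by (intro add_subgroup_sumset add_subgroup_perp add_subgroup_Z)
  have XD: "?X \<subseteq> dual B"
    by (intro sumset_subset add_subgroup_dual perp_subset_dual Z_subset_dual B)
  obtain m where m: "m > 0" "\<And>d. d \<in> dual B \<Longrightarrow> real m *\<^sub>R d \<in> ?X"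
    using ex_dual_exponent[OF B] by blast
  have mk: "real_of_int (int m * k) *\<^sub>R d \<in> ?X" if "d \<in> dual B" for d k
    using add_subgroup_scaleR_int[OF X m(2)[OF that], of k] by (simp add: mult.commute)
  have "component_torsion B q = component_torsion B r" if "[q = r] (mod m)" for q r
  proof -
    have "int m dvd int q - int r" using that by (simp add: cong_int_iff[symmetric] cong_iff_dvd_diff)
    then obtain k where k: "int q - int r = int m * k" by blast
    have "real q *\<^sub>R d \<in> ?X \<longleftrightarrow> real r *\<^sub>R d \<in> ?X" if "d \<in> dual B" for d
    proof -
      have "real q *\<^sub>R d - real r *\<^sub>R d = real_of_int (int q - int r) *\<^sub>R d"
        by (simp add: scaleR_diff_left)
      then have *: "real q *\<^sub>R d - real r *\<^sub>R d \<in> ?X" using mk[OF that] k by metis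
      show ?thesis
      proof
        assume "real q *\<^sub>R d \<in> ?X"
        from add_subgroupD(2)[OF X this *] show "real r *\<^sub>R d \<in> ?X" by simp
      next
        assume "real r *\<^sub>R d \<in> ?X"
        from add_subgroupD(4)[OF X this *] show "real q *\<^sub>R d \<in> ?X" by simp
      qed
    qed
    then have "{d \<in> dual B. real q *\<^sub>R d \<in> ?X} = {d \<in> dual B. real r *\<^sub>R d \<in> ?X}" by blast
    then show ?thesis by (simp add: component_torsion_def)
  qed
  moreover have "component_torsion B q = 1" if "coprime q m" for q
  proof -
    have "gcd (int q) (int m) = 1" using that by (simp add: coprime_iff_gcd_eq_1[symmetric])
    then obtain u v where uv: "u * int q + v * int m = 1" using bezout_int[of "int q" "int m"] by auto
    have "d \<in> ?X" if d: "d \<in> dual B" "real q *\<^sub>R d \<in> ?X" for d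
    proof -
      have "real_of_int u *\<^sub>R real q *\<^sub>R d + real_of_int (int m * v) *\<^sub>R d \<in> ?X"
        using add_subgroupD(4)[OF X add_subgroup_scaleR_int[OF X d(2)] mk[OF d(1)]] .
      moreover have "real_of_int u *\<^sub>R real q *\<^sub>R d + real_of_int (int m * v) *\<^sub>R d
          = real_of_int (u * int q + v * int m) *\<^sub>R d"
        by (simp add: algebra_simps)
      ultimately show ?thesis by (simp add: uv)
    qed
    then have "{d \<in> dual B. real q *\<^sub>R d \<in> ?X} = ?X"
      using XD add_subgroup_scaleR_int[OF X, of _ "int q"] by auto
    moreover have "cosets ?X ?X = {?X}"
    proof -
      have "(+) x ` ?X = (+) 0 ` ?X" if "x \<in> ?X" for x
        using that by (simp only: coset_eq_iff[OF X] diff_zero)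
      then show ?thesis using add_subgroupD(1)[OF X] by (force simp: cosets_def)
    qed
    ultimately show ?thesis by (simp add: component_torsion_def)
  qed
  ultimately show ?thesis using m by blast
qed

end

lemma rcong_0_iff_divide_Ints:
  fixes y :: real
  assumes "q > 0" shows "[y = 0] (rmod q) \<longleftrightarrow> y / q \<in> \<int>"
proof -
  have "[y = 0] (rmod q) \<longleftrightarrow> [0 = y] (rmod q)" by (rule rcong_sym_iff)
  also have "\<dots> \<longleftrightarrow> (\<exists>n. y / q = of_int n)"
    using assms by (simp add: rcong_altdef field_simps)
  finally show ?thesis by (auto simp: Ints_def)
qed

lemma sum_Pow_alternating:
  assumes "finite A"
  shows "(\<Sum>B\<in>Pow A. (- 1) ^ card B :: 'b::comm_ring_1) = (if A = {} then 1 else 0)"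
proof -
  have "(\<Sum>B\<in>Pow A. (- 1) ^ card B :: 'b) = (\<Prod>x\<in>A. (- 1) + 1)"
    by (subst prod_add[OF assms]) (simp add: prod_constant)
  then show ?thesis using assms by (simp add: power_0_left)
qed

context root_sys
begin

lemma coset_eq: "H #>\<^bsub>coweight_group \<Phi>\<^esub> x = (+) x ` H"
  by (auto simp: r_coset_def coweight_group_def add.commute)

text \<open>A class \<open>K\<close> belongs to the complement iff the set \<open>S K\<close> of roots that vanish on it modulo \<open>q\<close> is
  empty, and the alternating sum over the subsets of \<open>S K\<close> detects this. After exchanging the sums,
  the classes with \<open>B \<subseteq> S K\<close> are those counted by \<open>idx_div_lattice\<close>.\<close>

lemma char_quasi_inclusion_exclusion:
  assumes q: "q > 0"
  shows "int (char_quasi \<Phi> q) =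
    (\<Sum>B\<in>Pow \<Phi>. (- 1) ^ card B * int q ^ dim (perp B) * int (component_torsion B q))"
proof -
  let ?qZ = "scaled_coweight_lattice \<Phi> q"
  define Q where "Q = cosets Z ?qZ"
  define S where "S K = {\<beta> \<in> \<Phi>. \<exists>x\<in>K. (\<beta> \<bullet> x) / real q \<in> \<int>}" for K
  have S: "S ((+) x ` ?qZ) = {\<beta> \<in> \<Phi>. (\<beta> \<bullet> x) / real q \<in> \<int>}" if x: "x \<in> Z" for x
  proof -
    have "(\<beta> \<bullet> (x + real q *\<^sub>R z)) / real q \<in> \<int> \<longleftrightarrow> (\<beta> \<bullet> x) / real q \<in> \<int>"
      if "\<beta> \<in> \<Phi>" "z \<in> Z" for \<beta> z
    proof -
      have "\<beta> \<bullet> z \<in> \<int>" using that by (simp add: coweight_lattice_def)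
      moreover have "(\<beta> \<bullet> (x + real q *\<^sub>R z)) / real q = (\<beta> \<bullet> x) / real q + \<beta> \<bullet> z"
        using q by (simp add: inner_right_distrib add_divide_distrib)
      ultimately show ?thesis by simp
    qed
    moreover have "0 \<in> Z" using add_subgroupD(1)[OF add_subgroup_Z] .
    ultimately show ?thesis unfolding S_def scaled_coweight_lattice_def by auto
  qed
  have rc: "[\<beta> \<bullet> x = 0] (rmod real q) \<longleftrightarrow> (\<beta> \<bullet> x) / real q \<in> \<int>" for \<beta> x :: 'a
    using q by (intro rcong_0_iff_divide_Ints) simp
  have M: "mod_complement \<Phi> q = {K \<in> Q. S K = {}}"
    by (auto simp: mod_complement_def coset_eq rc Q_def cosets_def S)
  have filter: "{K \<in> Q. B \<subseteq> S K} = cosets (div_lattice B q) ?qZ" if "B \<subseteq> \<Phi>" for B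
  proof -
    have "{K \<in> Q. B \<subseteq> S K} = (\<lambda>x. (+) x ` ?qZ) ` {x \<in> Z. B \<subseteq> S ((+) x ` ?qZ)}"
      unfolding Q_def cosets_def by blast
    also have "{x \<in> Z. B \<subseteq> S ((+) x ` ?qZ)} = div_lattice B q"
      using that by (auto simp: S div_lattice_def)
    finally show ?thesis by (simp add: cosets_def)
  qed
  have "idx (div_lattice {} q) ?qZ = q ^ dim (perp ({}::'a set)) * component_torsion {} q"
    by (rule idx_div_lattice[OF _ q]) auto
  moreover have "component_torsion {} q > 0"
  proof -
    have "sumset UNIV Z = UNIV"
      using sumset_left[OF add_subgroup_Z, of UNIV] by auto
    then show ?thesis using coset_eq_iff[of UNIV]
      by (simp add: component_torsion_def perp_def dual_def cosets_def)
  qed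
  ultimately have "card Q > 0" using q filter[of "{}"] by simp
  then have fin: "finite Q" by (rule card_ge_0_finite)
  have finS: "finite (S K)" for K using finite_roots by (simp add: S_def)
  have "int (char_quasi \<Phi> q) = (\<Sum>K\<in>Q. if S K = {} then 1 else 0)"
    by (simp add: char_quasi_def M sum.If_cases fin Int_def)
  also have "\<dots> = (\<Sum>K\<in>Q. \<Sum>B\<in>Pow (S K). (- 1) ^ card B)"
    by (simp add: sum_Pow_alternating finS)
  also have "\<dots> = (\<Sum>K\<in>Q. \<Sum>B\<in>{B \<in> Pow \<Phi>. B \<subseteq> S K}. (- 1) ^ card B)"
    by (intro sum.cong refl) (auto simp: S_def)
  also have "\<dots> = (\<Sum>B\<in>Pow \<Phi>. \<Sum>K\<in>{K \<in> Q. B \<subseteq> S K}. (- 1) ^ card B)"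
    using finite_roots fin by (intro sum.swap_restrict) auto
  also have "\<dots> = (\<Sum>B\<in>Pow \<Phi>. (- 1) ^ card B * int q ^ dim (perp B) * int (component_torsion B q))"
    by (intro sum.cong refl) (simp add: filter idx_div_lattice q)
  finally show ?thesis .
qed

lemma component_torsion_periodic_uniform:
  obtains N where "N > 0"
    "\<forall>B q r. B \<subseteq> \<Phi> \<longrightarrow> [q = r] (mod N) \<longrightarrow> component_torsion B q = component_torsion B r"
    "\<forall>B q. B \<subseteq> \<Phi> \<longrightarrow> coprime q N \<longrightarrow> component_torsion B q = 1"
proof -
  have "\<forall>B\<in>Pow \<Phi>. \<exists>m>0. (\<forall>q r. [q = r] (mod m) \<longrightarrow> component_torsion B q = component_torsion B r) \<and>
               (\<forall>q. coprime q m \<longrightarrow> component_torsion B q = 1)"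
    using component_torsion_periodic by simp
  from bchoice[OF this] obtain m where m':
    "\<forall>B\<in>Pow \<Phi>. m B > 0 \<and> (\<forall>q r. [q = r] (mod m B) \<longrightarrow> component_torsion B q = component_torsion B r) \<and>
       (\<forall>q. coprime q (m B) \<longrightarrow> component_torsion B q = 1)" by blast
  have m: "m B > 0" "[q = r] (mod m B) \<Longrightarrow> component_torsion B q = component_torsion B r"
    "coprime q (m B) \<Longrightarrow> component_torsion B q = 1" if "B \<subseteq> \<Phi>" for B q r
    using m' that by blast+
  have dvd: "m B dvd (\<Prod>B\<in>Pow \<Phi>. m B)" if "B \<subseteq> \<Phi>" for B
    using that finite_roots by (intro dvd_prodI) auto
  show thesis
  proof (rule that[of "\<Prod>B\<in>Pow \<Phi>. m B"])
    show "(\<Prod>B\<in>Pow \<Phi>. m B) > 0" using m(1) by (intro prod_pos) auto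
  next
    show "\<forall>B q r. B \<subseteq> \<Phi> \<longrightarrow> [q = r] (mod (\<Prod>B\<in>Pow \<Phi>. m B)) \<longrightarrow> component_torsion B q = component_torsion B r"
      using m(2)[OF _ cong_dvd_modulus_nat[OF _ dvd]] by blast
  next
    show "\<forall>B q. B \<subseteq> \<Phi> \<longrightarrow> coprime q (\<Prod>B\<in>Pow \<Phi>. m B) \<longrightarrow> component_torsion B q = 1"
      using m(3)[OF _ coprime_divisors[OF dvd_refl dvd]] by blast
  qed
qed

end

section \<open>The characteristic polynomial and the minimum period\<close>

lemma perp_eq_Inter: "perp B = (\<Inter>\<beta>\<in>B. {x. \<beta> \<bullet> x = 0})"
  by (auto simp: perp_def)

lemma intersection_lattice_coxeter:
  "intersection_lattice (coxeter_arrangement \<Phi>) = perp ` Pow \<Phi>"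
proof -
  have "coxeter_arrangement \<Phi> = (\<lambda>\<beta>. {x. \<beta> \<bullet> x = 0}) ` \<Phi>"
    by (auto simp: coxeter_arrangement_def)
  then show ?thesis
    unfolding intersection_lattice_def perp_eq_Inter
    by (auto simp: subset_image_iff)
qed

text \<open>Whitney's formula. The right-hand side satisfies the recursion of the Moebius function:
  summed over all flats that contain \<open>X\<close>, it runs over all sets of roots vanishing on \<open>X\<close>, and this
  alternating sum is \<open>0\<close> unless no root vanishes on \<open>X\<close>.\<close>

lemma moebius_eq_alternating_sum:
  fixes \<Phi> :: "'a::euclidean_space set"
  assumes fin: "finite \<Phi>" and nz: "0 \<notin> \<Phi>" and X: "X \<in> perp ` Pow \<Phi>"
  shows "moebius (perp ` Pow \<Phi>) X = (\<Sum>B | B \<subseteq> \<Phi> \<and> perp B = X. (- 1) ^ card B)"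
  using X
proof (induction "card {Y \<in> perp ` Pow \<Phi>. X \<subset> Y}" arbitrary: X rule: less_induct)
  case less
  let ?L = "perp ` Pow \<Phi>"
  let ?\<nu> = "\<lambda>X. \<Sum>B | B \<subseteq> \<Phi> \<and> perp B = X. (- 1) ^ card B :: int"
  have finL: "finite ?L" using fin by simp
  show ?case
  proof (cases "X = UNIV")
    case True
    have "B = {}" if "B \<subseteq> \<Phi>" "perp B = UNIV" for B
    proof -
      have "b \<bullet> b = 0" if "b \<in> B" for b
        using that \<open>perp B = UNIV\<close> by (auto simp: perp_def set_eq_iff)
      then show ?thesis using that nz by auto
    qed
    then have "{B. B \<subseteq> \<Phi> \<and> perp B = X} = {{}}" using True by (auto simp: perp_def)
    then show ?thesis using True by (subst moebius.simps) (simp add: finL)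
  next
    case False
    let ?A = "{\<beta> \<in> \<Phi>. \<forall>x\<in>X. \<beta> \<bullet> x = 0}"
    obtain B0 where B0: "B0 \<subseteq> \<Phi>" "X = perp B0" using less.prems by auto
    then have "B0 \<noteq> {}" using False by (auto simp: perp_def)
    \<comment> \<open>The roots that vanish on \<open>X\<close>; some do, because \<open>X\<close> is a proper flat.\<close>
    then have A: "?A \<noteq> {}" using B0 by (auto simp: perp_def)
    have "(\<Sum>Y\<in>{Y \<in> ?L. X \<subseteq> Y}. ?\<nu> Y) = (\<Sum>Y\<in>{Y \<in> ?L. X \<subseteq> Y}. \<Sum>B | B \<in> Pow ?A \<and> perp B = Y. (- 1) ^ card B)"
    proof (intro sum.cong refl)
      fix Y assume "Y \<in> {Y \<in> ?L. X \<subseteq> Y}"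
      then have XY: "X \<subseteq> Y" by simp
      have "B \<subseteq> ?A" if "B \<subseteq> \<Phi>" "X \<subseteq> perp B" for B
        using that by (auto simp: perp_def)
      with XY have "B \<subseteq> \<Phi> \<and> perp B = Y \<longleftrightarrow> B \<in> Pow ?A \<and> perp B = Y" for B
        by blast
      then show "{B. B \<subseteq> \<Phi> \<and> perp B = Y} = {B. B \<in> Pow ?A \<and> perp B = Y}"
        by simp
    qed
    also have "\<dots> = (\<Sum>B\<in>Pow ?A. (- 1) ^ card B)"
      using fin finL by (intro sum.group) (auto simp: perp_def)
    also have "\<dots> = 0" using A fin by (simp add: sum_Pow_alternating)
    finally have "(\<Sum>Y\<in>{Y \<in> ?L. X \<subseteq> Y}. ?\<nu> Y) = 0" .
    moreover have "{Y \<in> ?L. X \<subseteq> Y} = insert X {Y \<in> ?L. X \<subset> Y}" using less.prems by auto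
    ultimately have "?\<nu> X = - (\<Sum>Y\<in>{Y \<in> ?L. X \<subset> Y}. ?\<nu> Y)" using finL by simp
    also have "(\<Sum>Y\<in>{Y \<in> ?L. X \<subset> Y}. ?\<nu> Y) = (\<Sum>Y\<in>{Y \<in> ?L. X \<subset> Y}. moebius ?L Y)"
    proof (intro sum.cong refl)
      fix Y assume Y: "Y \<in> {Y \<in> ?L. X \<subset> Y}"
      then have "{Z \<in> ?L. Y \<subset> Z} \<subset> {Z \<in> ?L. X \<subset> Z}" by auto
      then have "card {Z \<in> ?L. Y \<subset> Z} < card {Z \<in> ?L. X \<subset> Z}"
        using finL by (intro psubset_card_mono) auto
      then show "?\<nu> Y = moebius ?L Y" using less.hyps[of Y] Y by simp
    qed
    finally show ?thesis using False finL by (subst moebius.simps) simp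
  qed
qed

lemma arrangement_char_poly_whitney:
  fixes \<Phi> :: "'a::euclidean_space set"
  assumes fin: "finite \<Phi>" and nz: "0 \<notin> \<Phi>"
  shows "arrangement_char_poly (coxeter_arrangement \<Phi>) =
    (\<Sum>B\<in>Pow \<Phi>. Polynomial.monom ((- 1) ^ card B) (dim (perp B)))"
proof -
  have "(\<Sum>B\<in>Pow \<Phi>. Polynomial.monom ((- 1) ^ card B) (dim (perp B)) :: int poly) =
    (\<Sum>X\<in>perp ` Pow \<Phi>. \<Sum>B\<in>{B \<in> Pow \<Phi>. perp B = X}. Polynomial.monom ((- 1) ^ card B) (dim (perp B)))"
    using fin by (intro sum.image_gen) simp
  also have "\<dots> = (\<Sum>X\<in>perp ` Pow \<Phi>. Polynomial.monom (moebius (perp ` Pow \<Phi>) X) (dim X))"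
  proof (intro sum.cong refl)
    fix X assume X: "X \<in> perp ` Pow \<Phi>"
    have "(\<Sum>B\<in>{B \<in> Pow \<Phi>. perp B = X}. Polynomial.monom ((- 1) ^ card B) (dim (perp B)) :: int poly)
      = (\<Sum>B | B \<subseteq> \<Phi> \<and> perp B = X. Polynomial.monom ((- 1) ^ card B) (dim X))"
      by (intro sum.cong) auto
    also have "\<dots> = Polynomial.monom (\<Sum>B | B \<subseteq> \<Phi> \<and> perp B = X. (- 1) ^ card B) (dim X)"
      by (rule poly_eqI) (simp add: coeff_sum)
    finally show "(\<Sum>B\<in>{B \<in> Pow \<Phi>. perp B = X}. Polynomial.monom ((- 1) ^ card B) (dim (perp B)) :: int poly)
      = Polynomial.monom (moebius (perp ` Pow \<Phi>) X) (dim X)"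
      by (simp add: moebius_eq_alternating_sum[OF fin nz X])
  qed
  finally show ?thesis by (simp add: arrangement_char_poly_def intersection_lattice_coxeter)
qed

text \<open>Let \<open>m\<close> be the product of the primes that divide \<open>N\<close> but not \<open>q\<close>. A prime divisor of \<open>N\<close> divides
  exactly one of \<open>q\<close> and \<open>n m\<close>, because \<open>q\<close> is coprime to \<open>n\<close>.\<close>

lemma ex_coprime_in_residue_class:
  fixes q n N :: nat
  assumes "coprime q n" and N: "N > 0"
  shows "\<exists>m. coprime (q + n * m) N"
proof -
  define m where "m = \<Prod>{p. prime p \<and> p dvd N \<and> \<not> p dvd q}"
  have fin: "finite {p. prime p \<and> p dvd N \<and> \<not> p dvd q}"
    by (rule finite_subset[of _ "{..N}"]) (use N in \<open>auto dest: dvd_imp_le\<close>)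
  have "coprime (q + n * m) N"
  proof (rule ccontr)
    assume "\<not> ?thesis"
    then have "gcd (q + n * m) N \<noteq> 1" by (simp add: coprime_iff_gcd_eq_1)
    then obtain p where "prime p" "p dvd gcd (q + n * m) N" using prime_factor_nat by blast
    then have p: "prime p" "p dvd q + n * m" "p dvd N" by auto
    show False
    proof (cases "p dvd q")
      case True
      then have "p dvd n * m" using p(2) by (simp add: dvd_add_right_iff)
      moreover have "\<not> p dvd n"
        using True assms(1) p(1) by (meson coprime_common_divisor not_prime_unit)
      ultimately have "p dvd m" using p(1) by (simp add: prime_dvd_mult_iff)
      then obtain r where r: "prime r" "p dvd r" "\<not> r dvd q"
        using fin p(1) by (auto simp: m_def prime_dvd_prod_iff)
      then have "p = r" using p(1) by (simp add: primes_dvd_imp_eq)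
      then show False using r True by simp
    next
      case False
      then have "p dvd m" using p fin unfolding m_def by (intro dvd_prodI[where f = "\<lambda>p. p", simplified]) auto
      then have "p dvd q" using p(2) by (metis dvd_add_left_iff dvd_mult)
      then show False using False by simp
    qed
  qed
  then show ?thesis ..
qed

context root_sys
begin

lemma ex_quasi_period: "\<exists>n. quasi_period (char_quasi \<Phi>) n"
proof -
  obtain N where N: "N > 0" "\<forall>B q r. B \<subseteq> \<Phi> \<longrightarrow> [q = r] (mod N) \<longrightarrow> component_torsion B q = component_torsion B r"
    "\<forall>B q. B \<subseteq> \<Phi> \<longrightarrow> coprime q N \<longrightarrow> component_torsion B q = 1"
    by (rule component_torsion_periodic_uniform)
  define f where "f r = (\<Sum>B\<in>Pow \<Phi>. Polynomial.monom ((- 1) ^ card B * real (component_torsion B r)) (dim (perp B)))" for r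
  have "real (char_quasi \<Phi> q) = poly (f r) (real q)" if "q > 0" "[q = r] (mod N)" for q r
  proof -
    have "real (char_quasi \<Phi> q) = of_int (int (char_quasi \<Phi> q))" by simp
    also have "\<dots> = (\<Sum>B\<in>Pow \<Phi>. (- 1) ^ card B * real q ^ dim (perp B) * real (component_torsion B q))"
      by (simp add: char_quasi_inclusion_exclusion[OF that(1)])
    also have "\<dots> = poly (f r) (real q)"
      unfolding f_def poly_sum by (intro sum.cong refl) (use N(2)[rule_format, OF _ that(2)] in \<open>simp add: poly_monom\<close>)
    finally show ?thesis .
  qed
  then have "quasi_period (char_quasi \<Phi>) N" using N(1) unfolding quasi_period_def by blast
  then show ?thesis ..
qed

lemma ex_modulus_char_poly:
  "\<exists>N>0. \<forall>q>0. coprime q N \<longrightarrow>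
     int (char_quasi \<Phi> q) = poly (arrangement_char_poly (coxeter_arrangement \<Phi>)) (int q)"
proof -
  obtain N where N: "N > 0" "\<forall>B q r. B \<subseteq> \<Phi> \<longrightarrow> [q = r] (mod N) \<longrightarrow> component_torsion B q = component_torsion B r"
    "\<forall>B q. B \<subseteq> \<Phi> \<longrightarrow> coprime q N \<longrightarrow> component_torsion B q = 1"
    by (rule component_torsion_periodic_uniform)
  have "int (char_quasi \<Phi> q) = poly (arrangement_char_poly (coxeter_arrangement \<Phi>)) (int q)"
    if "q > 0" "coprime q N" for q
    using N(3)[rule_format, OF _ that(2)]
    by (simp add: char_quasi_inclusion_exclusion[OF that(1)]
        arrangement_char_poly_whitney[OF finite_roots zero_not_root] poly_sum poly_monom)
  with N(1) show ?thesis by blast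
qed

lemma of_int_char_poly:
  "real_of_int (poly (arrangement_char_poly (coxeter_arrangement \<Phi>)) (int k)) =
    poly (\<Sum>B\<in>Pow \<Phi>. Polynomial.monom ((- 1) ^ card B) (dim (perp B))) (real k)"
  by (simp add: arrangement_char_poly_whitney[OF finite_roots zero_not_root] poly_sum poly_monom)

text \<open>The constituent of the quasi-polynomial in the class of \<open>q\<close> modulo the minimum period agrees with
  the characteristic polynomial at the infinitely many members \<open>a k\<close> of the class that are coprime to
  \<open>N\<close>.\<close>

theorem char_quasi_eq_char_poly:
  assumes q: "q > 0" and cop: "coprime q (min_period (char_quasi \<Phi>))"
  shows "int (char_quasi \<Phi> q) = poly (arrangement_char_poly (coxeter_arrangement \<Phi>)) (int q)"
proof -
  let ?P = "arrangement_char_poly (coxeter_arrangement \<Phi>)"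
  define P :: "real poly" where "P = (\<Sum>B\<in>Pow \<Phi>. Polynomial.monom ((- 1) ^ card B) (dim (perp B)))"
  have P: "real_of_int (poly ?P (int k)) = poly P (real k)" for k
    unfolding P_def by (rule of_int_char_poly)
  let ?n = "min_period (char_quasi \<Phi>)"
  have "quasi_period (char_quasi \<Phi>) ?n"
    unfolding min_period_def using ex_quasi_period by (rule LeastI_ex)
  then obtain f :: "nat \<Rightarrow> real poly" where n: "?n > 0" and
    f: "\<And>r q. r \<in> {1..?n} \<Longrightarrow> q > 0 \<Longrightarrow> [q = r] (mod ?n) \<Longrightarrow> real (char_quasi \<Phi> q) = poly (f r) (real q)"
    unfolding quasi_period_def by blast
  \<comment> \<open>Residue classes are numbered from \<open>1\<close> to \<open>n\<close>, with \<open>n\<close> for the class of \<open>0\<close>.\<close>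
  define r where "r = (if q mod ?n = 0 then ?n else q mod ?n)"
  have r: "r \<in> {1..?n}" "[q = r] (mod ?n)"
    using n by (auto simp: r_def cong_def less_imp_le mod_less_divisor)
  obtain N where N: "N > 0" "\<And>q. q > 0 \<Longrightarrow> coprime q N \<Longrightarrow> int (char_quasi \<Phi> q) = poly ?P (int q)"
    using ex_modulus_char_poly by blast
  obtain m where m: "coprime (q + ?n * m) N" using ex_coprime_in_residue_class[OF cop N(1)] by blast
  define a where "a k = q + ?n * m + ?n * N * k" for k
  have agree: "poly (f r) (real (a k)) = poly P (real (a k))" for k
  proof -
    have ak: "a k = q + ?n * (m + N * k)" by (simp add: a_def algebra_simps)
    then have a: "a k > 0" "[a k = r] (mod ?n)"
      using q r(2) by (simp_all add: cong_def)
    have "a k = (q + ?n * m) + (?n * k) * N" by (simp add: a_def)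
    then have "coprime (a k) N" using m by (metis coprime_iff_gcd_eq_1 gcd.commute gcd_add_mult mult.commute add.commute)
    then have "int (char_quasi \<Phi> (a k)) = poly ?P (int (a k))" using N(2) a(1) by simp
    then have "real (char_quasi \<Phi> (a k)) = poly P (real (a k))" by (metis P of_int_of_nat_eq)
    then show ?thesis using f[OF r(1) a] by simp
  qed
  have "infinite (range (\<lambda>k. real (a k)))"
    using n N(1) by (intro range_inj_infinite) (auto simp: inj_on_def a_def)
  moreover have "range (\<lambda>k. real (a k)) \<subseteq> {x. poly (f r - P) x = 0}"
    using agree by auto
  ultimately have "f r - P = 0"
    using poly_roots_finite finite_subset by blast
  then have "real (char_quasi \<Phi> q) = poly P (real q)"
    using f[OF r(1) q r(2)] by simp
  then have "real_of_int (int (char_quasi \<Phi> q)) = real_of_int (poly ?P (int q))" by (simp add: P)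
  then show ?thesis by (simp only: of_int_eq_iff)
qed

end

section \<open>Fixed points of the Weyl group modulo q\<close>

context root_sys
begin

lemma root_inner_pos: "\<beta> \<in> \<Phi> \<Longrightarrow> \<beta> \<bullet> \<beta> > 0"
  using root_nonzero by simp

lemma reflection_eq: "reflection \<alpha> x = x - (\<alpha> \<bullet> x) *\<^sub>R coroot \<alpha>"
  by (simp add: reflection_def coroot_def inner_commute)

lemma coroot_inner: "\<beta> \<in> \<Phi> \<Longrightarrow> \<beta> \<bullet> coroot \<beta> = 2"
  using root_inner_pos[of \<beta>] by (simp add: coroot_def)

lemma linear_reflection: "linear (reflection \<alpha>)"
  unfolding reflection_eq by (intro linearI) (simp_all add: inner_right_distrib algebra_simps)

lemma reflection_reflection: "\<alpha> \<in> \<Phi> \<Longrightarrow> reflection \<alpha> (reflection \<alpha> x) = x"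
  by (simp add: reflection_eq inner_diff_right coroot_inner algebra_simps)

lemma norm_reflection:
  assumes "\<alpha> \<in> \<Phi>" shows "norm (reflection \<alpha> x) = norm x"
proof -
  have a: "\<alpha> \<bullet> \<alpha> \<noteq> 0" using root_inner_pos[OF assms] by simp
  have "reflection \<alpha> x \<bullet> reflection \<alpha> x = x \<bullet> x"
    using a by (simp add: reflection_def coroot_def inner_diff_left inner_diff_right inner_commute field_simps)
  then show ?thesis by (simp add: norm_eq_sqrt_inner)
qed

text \<open>The hyperplane \<open>\<beta> \<bullet> z = q k\<close> with normal vector of length one.\<close>

definition affine_root :: "real \<Rightarrow> 'a \<Rightarrow> int \<Rightarrow> 'a \<times> real" where
  "affine_root q \<beta> k = ((1 / norm \<beta>) *\<^sub>R \<beta>, q * of_int k / norm \<beta>)"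

definition affine_roots_scaled :: "real \<Rightarrow> ('a \<times> real) set" where
  "affine_roots_scaled q = {affine_root q \<beta> k | \<beta> k. \<beta> \<in> \<Phi>}"

lemma aff_affine_root: "aff (affine_root q \<beta> k) x = (\<beta> \<bullet> x - q * of_int k) / norm \<beta>"
  by (simp add: aff_def affine_root_def diff_divide_distrib)

lemma mirror_affine_root: "mirror (affine_root q \<beta> k) x = x - (\<beta> \<bullet> x - q * of_int k) *\<^sub>R coroot \<beta>"
proof -
  have "mirror (affine_root q \<beta> k) x = x - (2 * ((\<beta> \<bullet> x - q * of_int k) / norm \<beta>)) *\<^sub>R (1 / norm \<beta>) *\<^sub>R \<beta>"
    by (simp only: mirror_def aff_affine_root) (simp add: affine_root_def)
  then show ?thesis
    by (simp add: coroot_def power2_norm_eq_inner[symmetric] power2_eq_square)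
qed

lemma affine_roots_affine_roots_scaled:
  assumes q: "q > 0"
  shows "affine_roots (affine_roots_scaled q)"
proof
  fix u assume "u \<in> affine_roots_scaled q"
  then obtain \<beta> k where "\<beta> \<in> \<Phi>" "u = affine_root q \<beta> k" by (auto simp: affine_roots_scaled_def)
  then show "fst u \<bullet> fst u = 1"
    using root_nonzero by (simp add: affine_root_def power2_norm_eq_inner[symmetric] power2_eq_square)
next
  fix u v assume "u \<in> affine_roots_scaled q" "v \<in> affine_roots_scaled q"
  then obtain \<alpha> k \<beta> l where *: "\<alpha> \<in> \<Phi>" "u = affine_root q \<alpha> k" "\<beta> \<in> \<Phi>" "v = affine_root q \<beta> l"
    by (auto simp: affine_roots_scaled_def)
  obtain n where n: "\<beta> \<bullet> coroot \<alpha> = of_int n"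
    using cartan_integer[OF *(1,3)] by (auto elim: Ints_cases)
  have nz: "norm \<alpha> \<noteq> 0" "norm \<beta> \<noteq> 0" using * root_nonzero by auto
  have "2 * (\<alpha> \<bullet> \<beta>) = of_int n * (norm \<alpha>)\<^sup>2"
    using n nz by (simp add: coroot_def power2_norm_eq_inner inner_commute field_simps)
  then have c: "2 * (fst u \<bullet> fst v) = of_int n * norm \<alpha> / norm \<beta>"
    using nz by (simp add: * affine_root_def power2_eq_square field_simps)
  have refl: "reflection \<alpha> \<beta> = \<beta> - of_int n *\<^sub>R \<alpha>" by (simp add: reflection_def n)
  have "mirror_root u v = affine_root q (reflection \<alpha> \<beta>) (l - n * k)"
    using nz norm_reflection[OF *(1), of \<beta>]
    by (simp add: mirror_root_def c) (simp add: * affine_root_def refl field_simps scaleR_diff_right)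
  then show "mirror_root u v \<in> affine_roots_scaled q"
    using reflection_root * by (auto simp: affine_roots_scaled_def)
next
  fix y z :: 'a
  have "{u \<in> affine_roots_scaled q. aff u y > 0 \<and> aff u z < 0} \<subseteq>
    (\<Union>\<beta>\<in>\<Phi>. affine_root q \<beta> ` {\<lfloor>\<beta> \<bullet> z / q\<rfloor>..\<lceil>\<beta> \<bullet> y / q\<rceil>})"
  proof
    fix u assume "u \<in> {u \<in> affine_roots_scaled q. aff u y > 0 \<and> aff u z < 0}"
    then obtain \<beta> k where *: "\<beta> \<in> \<Phi>" "u = affine_root q \<beta> k" "aff u y > 0" "aff u z < 0"
      by (auto simp: affine_roots_scaled_def)
    have "norm \<beta> > 0" using * root_nonzero by simp
    then have "q * of_int k < \<beta> \<bullet> y" "\<beta> \<bullet> z < q * of_int k"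
      using *(3,4) by (simp_all add: *(2) aff_affine_root zero_less_divide_iff divide_less_0_iff)
    then have "of_int k < \<beta> \<bullet> y / q" "\<beta> \<bullet> z / q < of_int k"
      using q by (simp_all add: field_simps)
    then have "k \<in> {\<lfloor>\<beta> \<bullet> z / q\<rfloor>..\<lceil>\<beta> \<bullet> y / q\<rceil>}" by (simp add: floor_le_iff le_ceiling_iff)
    then show "u \<in> (\<Union>\<beta>\<in>\<Phi>. affine_root q \<beta> ` {\<lfloor>\<beta> \<bullet> z / q\<rfloor>..\<lceil>\<beta> \<bullet> y / q\<rceil>})" using * by blast
  qed
  then show "finite {u \<in> affine_roots_scaled q. aff u y > 0 \<and> aff u z < 0}"
    by (rule finite_subset) (use finite_roots in auto)
qed

lemma reflection_eq_mirror: "reflection \<beta> = mirror (affine_root q \<beta> 0)"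
  by (auto simp: mirror_affine_root reflection_eq)

text \<open>Reflecting in two parallel hyperplanes is a translation by twice their distance. For \<open>\<beta> \<bullet> x = 0\<close>
  and \<open>\<beta> \<bullet> x = q k\<close> it is the translation by \<open>q k\<close> times the coroot.\<close>

lemma translation_eq_mirrors:
  assumes "\<beta> \<in> \<Phi>"
  shows "(\<lambda>x. x + (q * of_int k) *\<^sub>R coroot \<beta>) = mirrors [affine_root q \<beta> k, affine_root q \<beta> 0]"
  by (simp add: fun_eq_iff mirror_affine_root inner_diff_right coroot_inner[OF assms] algebra_simps)

definition affine_weyl :: "real \<Rightarrow> ('a \<Rightarrow> 'a) set" where
  "affine_weyl q = mirrors ` {us. set us \<subseteq> affine_roots_scaled q}"

lemma affine_weyl_id: "id \<in> affine_weyl q"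
  unfolding affine_weyl_def by (intro image_eqI[of _ _ "[]"]) auto

lemma affine_weyl_comp:
  assumes "f \<in> affine_weyl q" "g \<in> affine_weyl q" shows "f \<circ> g \<in> affine_weyl q"
proof -
  obtain us vs where "set us \<subseteq> affine_roots_scaled q" "f = mirrors us"
    "set vs \<subseteq> affine_roots_scaled q" "g = mirrors vs"
    using assms by (auto simp: affine_weyl_def)
  then show ?thesis
    unfolding affine_weyl_def by (intro image_eqI[of _ _ "us @ vs"]) (auto simp: mirrors_append)
qed

lemma affine_root_in: "\<beta> \<in> \<Phi> \<Longrightarrow> affine_root q \<beta> k \<in> affine_roots_scaled q"
  by (auto simp: affine_roots_scaled_def)

lemma reflection_in_affine_weyl: "\<beta> \<in> \<Phi> \<Longrightarrow> reflection \<beta> \<in> affine_weyl q"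
  unfolding affine_weyl_def
  by (intro image_eqI[of _ _ "[affine_root q \<beta> 0]"])
    (simp_all add: reflection_eq_mirror[symmetric] affine_root_in)

lemma coroot_translation_in_affine_weyl:
  "\<beta> \<in> \<Phi> \<Longrightarrow> (\<lambda>x. x + (q * of_int k) *\<^sub>R coroot \<beta>) \<in> affine_weyl q"
  unfolding affine_weyl_def translation_eq_mirrors
  by (rule imageI) (simp add: affine_root_in)

theorem affine_weyl_free:
  assumes q: "q > 0" and g: "g \<in> affine_weyl q"
    and x: "\<And>\<beta> k. \<beta> \<in> \<Phi> \<Longrightarrow> \<beta> \<bullet> x \<noteq> q * of_int k" and fixed: "g x = x"
  shows "g = id"
proof -
  interpret affine_roots "affine_roots_scaled q" using q by (rule affine_roots_affine_roots_scaled)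
  interpret chamber "affine_roots_scaled q" x
    by unfold_locales (use x root_nonzero in \<open>auto simp: affine_roots_scaled_def aff_affine_root\<close>)
  show ?thesis using mirrors_free g fixed by (auto simp: affine_weyl_def)
qed

lemma coweight_group_simps [simp]:
  "carrier (coweight_group \<Phi>) = Z" "x \<otimes>\<^bsub>coweight_group \<Phi>\<^esub> y = x + y" "\<one>\<^bsub>coweight_group \<Phi>\<^esub> = 0"
  by (simp_all add: coweight_group_def)

lemma comm_group_coweight: "comm_group (coweight_group \<Phi>)"
proof (rule comm_groupI)
  show "\<exists>y\<in>carrier (coweight_group \<Phi>). y \<otimes>\<^bsub>coweight_group \<Phi>\<^esub> x = \<one>\<^bsub>coweight_group \<Phi>\<^esub>"
    if "x \<in> carrier (coweight_group \<Phi>)" for x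
    using that add_subgroupD(3)[OF add_subgroup_Z] by (intro bexI[of _ "- x"]) auto
qed (auto intro: add_subgroupD[OF add_subgroup_Z])

lemma coweight_inv: "x \<in> Z \<Longrightarrow> inv\<^bsub>coweight_group \<Phi>\<^esub> x = - x"
  using add_subgroupD(3)[OF add_subgroup_Z, of x]
  by (intro group.inv_equality comm_group.axioms(2)[OF comm_group_coweight]) auto

lemma coweight_pow: "x [^]\<^bsub>coweight_group \<Phi>\<^esub> (n::nat) = real n *\<^sub>R x"
  by (induction n) (simp_all add: algebra_simps)

abbreviation Q where "Q \<equiv> coroot_lattice \<Phi>"

lemma subgroup_Q: "subgroup Q (coweight_group \<Phi>)"
  unfolding coroot_lattice_def
  by (intro group.generate_is_subgroup comm_group.axioms(2)[OF comm_group_coweight])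
    (auto simp: coroot_in_Z)

lemma Q_subset_Z: "Q \<subseteq> Z"
  using subgroup.subset[OF subgroup_Q] by simp

lemma add_subgroup_Q: "add_subgroup Q"
proof -
  have "x - y \<in> Q" if "x \<in> Q" "y \<in> Q" for x y
  proof -
    have "- y \<in> Q" using subgroup.m_inv_closed[OF subgroup_Q that(2)] Q_subset_Z that by (auto simp: coweight_inv)
    then show ?thesis using subgroup.m_closed[OF subgroup_Q that(1)] by fastforce
  qed
  then show ?thesis using subgroup.one_closed[OF subgroup_Q] by (simp add: add_subgroup_def)
qed

lemma coroot_in_Q: "\<beta> \<in> \<Phi> \<Longrightarrow> coroot \<beta> \<in> Q"
  by (simp add: coroot_lattice_def generate.incl)

text \<open>Lagrange's theorem in \<open>Z / Q\<close>. An infinite quotient would have order \<open>0\<close>, for which the claim is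
  trivial.\<close>

lemma index_of_connection_annihilates:
  assumes z: "z \<in> Z"
  shows "real (index_of_connection \<Phi>) *\<^sub>R z \<in> Q"
proof -
  let ?G = "coweight_group \<Phi>" and ?f = "index_of_connection \<Phi>"
  interpret G: comm_group ?G by (rule comm_group_coweight)
  interpret N: normal Q ?G using G.subgroup_imp_normal[OF subgroup_Q] .
  interpret M: group "?G Mod Q" by (rule N.factorgroup_is_group)
  have hom: "(\<lambda>a. Q #>\<^bsub>?G\<^esub> a) \<in> hom ?G (?G Mod Q)" by (rule N.r_coset_hom_Mod)
  have "Q #>\<^bsub>?G\<^esub> z \<in> carrier (?G Mod Q)" using hom z by (auto simp: hom_def)
  then have "(Q #>\<^bsub>?G\<^esub> z) [^]\<^bsub>?G Mod Q\<^esub> ?f = Q"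
    using M.pow_order_eq_1 by (simp add: index_of_connection_def FactGroup_def)
  moreover have "(Q #>\<^bsub>?G\<^esub> z) [^]\<^bsub>?G Mod Q\<^esub> ?f = Q #>\<^bsub>?G\<^esub> (z [^]\<^bsub>?G\<^esub> ?f)"
    using hom_nat_pow[OF hom _ G.is_group M.is_group, of z ?f] z by simp
  ultimately have "(+) (real ?f *\<^sub>R z) ` Q = (+) 0 ` Q" by (simp add: coweight_pow coset_eq)
  then have "real ?f *\<^sub>R z - 0 \<in> Q" by (simp only: coset_eq_iff[OF add_subgroup_Q])
  then show ?thesis by simp
qed

lemma translation_in_affine_weyl:
  assumes "v \<in> Q"
  shows "(\<lambda>x. x + q *\<^sub>R v) \<in> affine_weyl q"
  using assms unfolding coroot_lattice_def
proof (induction rule: generate.induct)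
  case one
  then show ?case using affine_weyl_id by (simp add: id_def)
next
  case (incl h)
  then show ?case using coroot_translation_in_affine_weyl[of _ q 1] by auto
next
  case (inv h)
  then obtain \<beta> where \<beta>: "\<beta> \<in> \<Phi>" "h = coroot \<beta>" by auto
  then show ?case using coroot_translation_in_affine_weyl[of \<beta> q "- 1"] coroot_in_Z
    by (simp add: coweight_inv)
next
  case (eng h1 h2)
  from affine_weyl_comp[OF eng.IH] show ?case by (simp add: o_def algebra_simps)
qed

lemma reflection_Bij: "\<alpha> \<in> \<Phi> \<Longrightarrow> reflection \<alpha> \<in> carrier (BijGroup UNIV)"
  unfolding BijGroup_def Bij_def using reflection_reflection
  by (auto intro!: bij_betwI[where g = "reflection \<alpha>"])

lemma weyl_group_one: "\<one>\<^bsub>weyl_group \<Phi>\<^esub> = id"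
  by (auto simp: weyl_group_def subgroup_generated_def BijGroup_def)

text \<open>Reflections are involutions, so the Weyl group is generated by them as a monoid.\<close>

lemma weyl_induct [consumes 1, case_names id reflection comp]:
  assumes w: "w \<in> carrier (weyl_group \<Phi>)"
    and "P id" and refl: "\<And>\<alpha>. \<alpha> \<in> \<Phi> \<Longrightarrow> P (reflection \<alpha>)"
    and "\<And>f g. P f \<Longrightarrow> P g \<Longrightarrow> P (f \<circ> g)"
  shows "P w"
proof -
  let ?G = "BijGroup (UNIV :: 'a set)"
  interpret G: group ?G by (rule group_BijGroup)
  have mult: "f \<otimes>\<^bsub>?G\<^esub> g = f \<circ> g" if "f \<in> carrier ?G" "g \<in> carrier ?G" for f g
    using that by (simp add: BijGroup_def compose_def fun_eq_iff)
  have unit: "\<one>\<^bsub>?G\<^esub> = id" by (auto simp: BijGroup_def)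
  have sub: "carrier ?G \<inter> reflection ` \<Phi> \<subseteq> carrier ?G" by simp
  have "w \<in> generate ?G (carrier ?G \<inter> reflection ` \<Phi>)"
    using w by (simp add: weyl_group_def carrier_subgroup_generated)
  then show ?thesis
  proof (induction rule: generate.induct)
    case one
    show ?case unfolding unit by (rule assms(2))
  next
    case (incl h)
    then show ?case using refl by auto
  next
    case (inv h)
    then obtain \<alpha> where \<alpha>: "\<alpha> \<in> \<Phi>" "h = reflection \<alpha>" by auto
    then have "h \<otimes>\<^bsub>?G\<^esub> h = \<one>\<^bsub>?G\<^esub>"
      by (auto simp: mult reflection_Bij unit reflection_reflection)
    then have "inv\<^bsub>?G\<^esub> h = h" using \<alpha> by (intro G.inv_equality) (auto simp: reflection_Bij)
    then show ?case using refl \<alpha> by simp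
  next
    case (eng h1 h2)
    then show ?case using assms(4) mult G.generate_in_carrier[OF sub] by metis
  qed
qed

lemma weyl_linear: "w \<in> carrier (weyl_group \<Phi>) \<Longrightarrow> linear w"
proof (induction rule: weyl_induct)
  case id
  show ?case by (rule linear_id)
next
  case (reflection \<alpha>)
  show ?case by (rule linear_reflection)
next
  case (comp f g)
  then show ?case by (intro linear_compose)
qed

lemma weyl_root: "w \<in> carrier (weyl_group \<Phi>) \<Longrightarrow> \<beta> \<in> \<Phi> \<Longrightarrow> w \<beta> \<in> \<Phi>"
proof (induction arbitrary: \<beta> rule: weyl_induct)
  case (reflection \<alpha>)
  then show ?case by (rule reflection_root)
qed auto

lemma weyl_in_affine_weyl: "w \<in> carrier (weyl_group \<Phi>) \<Longrightarrow> w \<in> affine_weyl q"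
  by (induction rule: weyl_induct)
    (rule affine_weyl_id reflection_in_affine_weyl affine_weyl_comp; assumption)+

text \<open>A reflection moves \<open>x\<close> by the integer \<open>\<alpha> \<bullet> x\<close> times a coroot.\<close>

lemma weyl_displacement: "w \<in> carrier (weyl_group \<Phi>) \<Longrightarrow> x \<in> Z \<Longrightarrow> w x - x \<in> Q"
proof (induction arbitrary: x rule: weyl_induct)
  case id
  then show ?case using add_subgroupD(1)[OF add_subgroup_Q] by simp
next
  case (reflection \<alpha>)
  then obtain k where "\<alpha> \<bullet> x = of_int k" by (auto simp: coweight_lattice_def elim: Ints_cases)
  then have "reflection \<alpha> x - x = of_int (- k) *\<^sub>R coroot \<alpha>" by (simp add: reflection_eq)
  then show ?case using add_subgroup_scaleR_int[OF add_subgroup_Q coroot_in_Q[OF reflection.hyps]] by metis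
next
  case (comp f g)
  have g: "g x - x \<in> Q" using comp by blast
  then have "x + (g x - x) \<in> Z" using add_subgroupD(4)[OF add_subgroup_Z comp.prems] Q_subset_Z by blast
  then have "f (g x) - g x \<in> Q" using comp.IH(1) by simp
  from add_subgroupD(4)[OF add_subgroup_Q this g] show ?case by simp
qed

text \<open>The Weyl group is finite, because a linear map is determined by its values on the spanning set
  of roots, which it permutes.\<close>

lemma order_weyl_pos: "Coset.order (weyl_group \<Phi>) > 0"
proof -
  let ?W = "carrier (weyl_group \<Phi>)"
  have "inj_on (\<lambda>w. restrict w \<Phi>) ?W"
  proof (intro inj_onI)
    fix f g assume fg: "f \<in> ?W" "g \<in> ?W" and eq: "restrict f \<Phi> = restrict g \<Phi>"
    have "f x = g x" for x
    proof (rule linear_eq_on_span[OF weyl_linear[OF fg(1)] weyl_linear[OF fg(2)]])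
      show "f \<beta> = g \<beta>" if "\<beta> \<in> \<Phi>" for \<beta> using fun_cong[OF eq, of \<beta>] that by simp
      show "x \<in> span \<Phi>" using span_roots by simp
    qed
    then show "f = g" by auto
  qed
  moreover have "(\<lambda>w. restrict w \<Phi>) ` ?W \<subseteq> \<Phi> \<rightarrow>\<^sub>E \<Phi>" using weyl_root by auto
  then have "finite ((\<lambda>w. restrict w \<Phi>) ` ?W)"
    using finite_roots by (meson finite_PiE finite_subset)
  ultimately have "finite ?W" by (simp add: finite_image_iff)
  moreover have "id \<in> ?W"
    using group.is_monoid[OF group.group_subgroup_generated[OF group_BijGroup]] monoid.one_closed weyl_group_one
    unfolding weyl_group_def by metis
  ultimately show ?thesis by (auto simp: Coset.order_def card_gt_0_iff)
qed

text \<open>If \<open>w\<close> fixes the class of \<open>x\<close>, then a translate of \<open>w\<close> by an element of \<open>q Q\<close> fixes \<open>x\<close> itself.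
  The condition on \<open>q\<close> serves to get the translation vector into \<open>q Q\<close> rather than only \<open>q Z\<close>, hence the
  translate into the affine Weyl group, which acts freely on the complement of its hyperplanes.\<close>

lemma no_fixed_points:
  assumes q: "q > 0" and cop: "coprime (index_of_connection \<Phi>) q"
    and w: "w \<in> carrier (weyl_group \<Phi>)" and K: "K \<in> mod_complement \<Phi> q" and fixed: "w ` K = K"
  shows "w = id"
proof -
  let ?qZ = "scaled_coweight_lattice \<Phi> q" and ?f = "index_of_connection \<Phi>"
  obtain x where x: "x \<in> Z" "K = (+) x ` ?qZ" "\<And>\<beta>. \<beta> \<in> \<Phi> \<Longrightarrow> \<not> [\<beta> \<bullet> x = 0] (rmod real q)"
    using K by (auto simp: mod_complement_def coset_eq)
  have "x + 0 \<in> K" unfolding x using add_subgroupD(1)[OF add_subgroup_scaled] by blast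
  then have "w x \<in> K" using fixed by (metis add_0_right imageI)
  then obtain z where z: "z \<in> Z" "w x = x + real q *\<^sub>R z"
    by (auto simp: x scaled_coweight_lattice_def)
  have qz: "real q *\<^sub>R z \<in> Q" using weyl_displacement[OF w x(1)] z by simp
  have fz: "real ?f *\<^sub>R z \<in> Q" by (rule index_of_connection_annihilates[OF z(1)])
  obtain u v where uv: "u * int ?f + v * int q = 1"
    using cop bezout_int[of "int ?f" "int q"] by (auto simp: coprime_iff_gcd_eq_1)
  have "real_of_int u *\<^sub>R real ?f *\<^sub>R z + real_of_int v *\<^sub>R real q *\<^sub>R z \<in> Q"
    by (intro add_subgroupD(4)[OF add_subgroup_Q] add_subgroup_scaleR_int[OF add_subgroup_Q] qz fz)
  moreover have "real_of_int u *\<^sub>R real ?f *\<^sub>R z + real_of_int v *\<^sub>R real q *\<^sub>R z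
    = real_of_int (u * int ?f + v * int q) *\<^sub>R z" by (simp add: algebra_simps)
  ultimately have zQ: "z \<in> Q" by (simp add: uv)
  define g where "g = (\<lambda>y. y + real q *\<^sub>R (- z)) \<circ> w"
  have "g = id"
  proof (rule affine_weyl_free[where q = "real q" and x = x])
    show "g \<in> affine_weyl (real q)"
      unfolding g_def using add_subgroupD(3)[OF add_subgroup_Q zQ]
      by (intro affine_weyl_comp translation_in_affine_weyl weyl_in_affine_weyl w)
    show "\<beta> \<bullet> x \<noteq> real q * of_int k" if "\<beta> \<in> \<Phi>" for \<beta> k
      using x(3)[OF that] q by (auto simp: rcong_0_iff_divide_Ints)
  qed (use q z in \<open>simp_all add: g_def\<close>)
  then have eq: "w y - real q *\<^sub>R z = y" for y by (simp add: g_def fun_eq_iff)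
  then have "real q *\<^sub>R z = 0" using eq[of 0] linear_0[OF weyl_linear[OF w]] by simp
  then show ?thesis using eq by (auto simp: fun_eq_iff)
qed

theorem perm_character_eq_regular:
  assumes q: "q > 0" and cop: "coprime (index_of_connection \<Phi>) q"
    and w: "w \<in> carrier (weyl_group \<Phi>)"
  shows "perm_character \<Phi> q w =
    of_nat (char_quasi \<Phi> q) / of_nat (Coset.order (weyl_group \<Phi>)) * regular_character (weyl_group \<Phi>) w"
proof (cases "w = id")
  case True
  then show ?thesis using order_weyl_pos
    by (simp add: perm_character_def invariants_def regular_character_def weyl_group_one char_quasi_def)
next
  case False
  then have "invariants (mod_complement \<Phi> q) (\<lambda>w t. w ` t) w = {}"
    using no_fixed_points[OF q cop w] by (auto simp: invariants_def)
  then show ?thesis using False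
    by (simp add: perm_character_def regular_character_def weyl_group_one)
qed

end

theorem corollary1p3:
  fixes \<Phi> :: "'a::euclidean_space set" and q :: nat
  assumes "root_system \<Phi>" and "reduced_roots \<Phi>" and "irreducible_roots \<Phi>" and "q > 0"
  shows
    "(gcd (index_of_connection \<Phi>) q = 1 \<longrightarrow>
       (\<forall>w \<in> carrier (weyl_group \<Phi>).
          perm_character \<Phi> q w =
            of_nat (char_quasi \<Phi> q) / of_nat (Coset.order (weyl_group \<Phi>)) *
              regular_character (weyl_group \<Phi>) w)) \<and>
     (coprime q (index_of_connection \<Phi>) \<and> coprime q (min_period (char_quasi \<Phi>)) \<longrightarrow>
       (\<forall>w \<in> carrier (weyl_group \<Phi>).
          perm_character \<Phi> q w =
            of_int (poly (arrangement_char_poly (coxeter_arrangement \<Phi>)) (int q)) /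
              of_nat (Coset.order (weyl_group \<Phi>)) *
              regular_character (weyl_group \<Phi>) w))"
proof (intro conjI impI ballI)
  interpret root_sys \<Phi> using assms(1) by unfold_locales
  fix w assume w: "w \<in> carrier (weyl_group \<Phi>)"
  show "perm_character \<Phi> q w =
      of_nat (char_quasi \<Phi> q) / of_nat (Coset.order (weyl_group \<Phi>)) *
        regular_character (weyl_group \<Phi>) w"
    if "gcd (index_of_connection \<Phi>) q = 1"
    using perm_character_eq_regular[OF assms(4) _ w] that by (simp add: coprime_iff_gcd_eq_1)
  show "perm_character \<Phi> q w =
      of_int (poly (arrangement_char_poly (coxeter_arrangement \<Phi>)) (int q)) /
        of_nat (Coset.order (weyl_group \<Phi>)) * regular_character (weyl_group \<Phi>) w"
    if cop: "coprime q (index_of_connection \<Phi>) \<and> coprime q (min_period (char_quasi \<Phi>))"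
  proof -
    have "(of_nat (char_quasi \<Phi> q) :: complex) = of_int (int (char_quasi \<Phi> q))" by simp
    then show ?thesis
      using perm_character_eq_regular[OF assms(4) _ w] char_quasi_eq_char_poly[OF assms(4)] cop
      by (simp add: coprime_commute)
  qed
qed

end
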